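(* Under the standing assumptions (i)–(iii) of the context, the dual spectral projected gradient algorithm described in the context, run with stopping parameter $\varepsilon = 0$, either terminates after reaching the optimal value $g^*$ of the dual problem $(\mathcal D)$ (that is, it stops at an iterate $U^k$ with $g(U^k)=g^*$), or it generates an infinite sequence $\{U^k\}$ that satisfies $$\lim_{k\to\infty} |g(U^k)-g^*| = 0 .$$
   Context: **Notation.** $\mathbb{S}^n$ is the space of real symmetric $n\times n$ matrices with inner product $C\bullet X=\sum_{i,j}C_{ij}X_{ij}$ and Frobenius norm $\|X\|=\sqrt{X\bullet X}$; $X\succ O$ ($X\succeq O$) means $X$ is positive definite (semidefinite). $\|y\|$ is the Euclidean norm of a vector, $\|y\|_p$ ($1\le p\le\infty$) is the usual $\ell_p$-norm. For a linear map, $^\top$ denotes the adjoint with respect to these inner products. $[a]_+=\max\{a,0\}$. For a closed convex set $\mathcal S$ in a Euclidean space, $P_{\mathcal S}$ is the orthogonal projection onto $\mathcal S$. **Primal problem.** Given $C\in\mathbb{S}^n$, $\mu>0$, $\lambda_1,\dots,\lambda_H\ge 0$, $p_1,\dots,p_H\in[1,\infty]$, linear maps $\mathcal{Q}_h:\mathbb{S}^n\to\mathbb{R}^{n_h}$, $b\in\mathbb{R}^m$, and $\mathcal{A}:\mathbb{S}^n\to\mathbb{R}^m$, $\mathcal{A}(X)=(A_1\bullet X,\dots,A_m\bullet X)^\top$ with $A_i\in\mathbb{S}^n$: $$(\mathcal P)\quad \min_{X\in\mathbb{S}^n} f(X):=C\bullet X-\mu\log\det X+\sum_{h=1}^H\lambda_h\|\mathcal{Q}_h(X)\|_{p_h}\quad\text{s.t.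 } \mathcal{A}(X)=b,\ X\succ O.$$ **Dual problem.** Let $p_h^*\in[1,\infty]$ be given by $1/p_h+1/p_h^*=1$, and $\mathcal{S}_h=\{\mathcal{Q}_h^\top(z): z\in\mathbb{R}^{n_h},\ \|z\|_{p_h^*}\le\lambda_h\}\subset\mathbb{S}^n$. Let $\mathcal{U}=\mathbb{R}^m\times\mathbb{S}^n\times\cdots\times\mathbb{S}^n$ ($H$ copies of $\mathbb{S}^n$), with $\langle U_1,U_2\rangle=y_1^\top y_2+\sum_{h}S^1_h\bullet S^2_h$ for $U_i=(y_i,S_1^i,\dots,S_H^i)$ and $\|U\|=\sqrt{\langle U,U\rangle}$. For $U=(y,S_1,\dots,S_H)$ put $\mathcal{B}(U)=-\mathcal{A}^\top(y)+\sum_{h=1}^H S_h$. The dual is $$(\mathcal D)\quad \max_{U\in\mathcal{U}} g(U):=b^\top y+\mu\log\det(C+\mathcal{B}(U))+n\mu-n\mu\log\mu\quad\text{s.t. } S_h\in\mathcal{S}_h\ (h=1,\dots,H),\ C+\mathcal{B}(U)\succ O,$$ with optimal value $g^*$. Let $\mathcal{M}=\{U\in\mathcal{U}: y\in\mathbb{R}^m, S_h\in\mathcal{S}_h\ \forall h\}$ and let $\mathcal{F}=\mathcal{M}\cap\{U: C+\mathcal{B}(U)\succ O\}$ be the feasible region of $(\mathcal D)$. Let $X(U)=\mu(C+\mathcal{B}(U))^{-1}$; then $\nabla g(U)=(b-\mathcal{A}(X(U)),X(U),\dots,X(U))$. **Standing assumptions.** (i) $A_1,\dots,A_m$ are linearly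 independent; (ii) there is $\widehat X\succ O$ with $\mathcal{A}(\widehat X)=b$; (iii) $\mathcal{F}\neq\emptyset$. **Algorithm.** Step 0: choose $\varepsilon\ge0$, $\tau,\gamma,\beta\in(0,1)$, $0<\alpha_{\min}<\alpha_{\max}<\infty$, an integer $M>0$, $U^0\in\mathcal{F}$, $\alpha_0\in[\alpha_{\min},\alpha_{\max}]$; set $k=0$. Step 1: $\Delta U^k_{(1)}:=P_{\mathcal{M}}(U^k+\nabla g(U^k))-U^k$. If $\|\Delta U^k_{(1)}\|\le\varepsilon$, terminate; otherwise go to Step 2. Step 2: $D^k:=P_{\mathcal{M}}(U^k+\alpha_k\nabla g(U^k))-U^k$. Let $L_kL_k^\top=C+\mathcal{B}(U^k)$ be a Cholesky factorization and $\theta$ the minimum eigenvalue of $L_k^{-1}\mathcal{B}(D^k)(L_k^\top)^{-1}$. Set $\nu_k=1$ if $\theta\ge0$ and $\nu_k=\min\{1,-\tau/\theta\}$ otherwise. Let $\sigma_k$ be the largest element of $\{1,\beta,\beta^2,\dots\}$ such that $$g(U^k+\sigma_k\nu_kD^k)\ge\min_{[k-M+1]_+\le l\le k}g(U^l)+\gamma\sigma_k\nu_k\langle\nabla g(U^k),D^k\rangle.$$ Step 3: $U^{k+1}=U^k+\sigma_k\nu_kD^k$; $p_k=\langle U^{k+1}-U^k,\nabla g(U^{k+1})-\nabla g(U^k)\rangle$; $\alpha_{k+1}=\alpha_{\max}$ if $p_k\ge0$, and $\alpha_{k+1}=\min\{\alpha_{\max},\max\{\alpha_{\min},-\|U^{k+1}-U^k\|^2/p_k\}\}$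 otherwise. Set $k\leftarrow k+1$ and return to Step 1. *)

theory Defs
  imports "HOL-Analysis.Analysis"
begin

text \<open>
  The space of symmetric matrices is treated as a subspace of \<^typ>\<open>real^'n^'n\<close>, whose library inner
  product and norm are the Frobenius ones.
\<close>

definition sym_mats :: "(real^'n^'n) set" where
  "sym_mats = {X. transpose X = X}"

definition pos_definite :: "real^'n^'n \<Rightarrow> bool" where
  "pos_definite X \<longleftrightarrow> X \<in> sym_mats \<and> (\<forall>v. v \<noteq> 0 \<longrightarrow> 0 < v \<bullet> (X *v v))"

definition linear_on_sym :: "(real^'n^'n \<Rightarrow> real) \<Rightarrow> bool" where
  "linear_on_sym \<phi> \<longleftrightarrow>
     (\<forall>X\<in>sym_mats. \<forall>Y\<in>sym_mats. \<forall>a b. \<phi> (a *\<^sub>R X + b *\<^sub>R Y) = a * \<phi> X + b * \<phi> Y)"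

text \<open>
  The symmetric matrix representing a linear functional on the symmetric matrices. The adjoint of a
  linear map \<open>F\<close> defined on symmetric matrices sends \<open>w\<close> to the representer of \<open>X \<mapsto> \<langle>F X, w\<rangle>\<close>.
  The library constant \<^const>\<open>adjoint\<close> is not used because it refers to the space of all matrices,
  and because the codomains below have varying dimension.
\<close>

definition sym_representer :: "(real^'n^'n \<Rightarrow> real) \<Rightarrow> real^'n^'n" where
  "sym_representer \<phi> = (THE Y. Y \<in> sym_mats \<and> (\<forall>X\<in>sym_mats. Y \<bullet> X = \<phi> X))"

lemma sym_representer_unique:
  fixes Y Z :: "real^'n^'n"
  assumes "Y \<in> sym_mats" "Z \<in> sym_mats" "\<forall>X\<in>sym_mats. Y \<bullet> X = Z \<bullet> X"
  shows "Y = Z"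
proof -
  have "Y - Z \<in> sym_mats"
    using assms(1,2) by (simp add: sym_mats_def transpose_def vec_eq_iff)
  then have "(Y - Z) \<bullet> (Y - Z) = 0"
    using assms(3) by (simp add: inner_diff_left)
  then show ?thesis by simp
qed

lemma sym_representer:
  fixes \<phi> :: "real^'n^'n \<Rightarrow> real"
  assumes "linear_on_sym \<phi>"
  shows "sym_representer \<phi> \<in> sym_mats" and "X \<in> sym_mats \<Longrightarrow> sym_representer \<phi> \<bullet> X = \<phi> X"
proof -
  define s :: "real^'n^'n \<Rightarrow> real^'n^'n" where "s = (\<lambda>X. (1/2) *\<^sub>R (X + transpose X))"
  have s_sym: "s X \<in> sym_mats" for X
    by (simp add: s_def sym_mats_def transpose_def vec_eq_iff algebra_simps)
  have s_id: "s X = X" if "X \<in> sym_mats" for X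
    using that by (simp add: s_def sym_mats_def scaleR_2 [symmetric])
  have s_add: "s (X + Y) = s X + s Y" and s_scale: "s (c *\<^sub>R X) = c *\<^sub>R s X" for X Y c
    by (simp_all add: s_def transpose_def vec_eq_iff algebra_simps)
  have comb: "\<phi> (a *\<^sub>R X + b *\<^sub>R Y) = a * \<phi> X + b * \<phi> Y"
    if "X \<in> sym_mats" "Y \<in> sym_mats" for X Y a b
    using assms that by (simp add: linear_on_sym_def)
  have lin: "linear (\<phi> \<circ> s)"
  proof (rule linearI)
    fix X Y
    show "(\<phi> \<circ> s) (X + Y) = (\<phi> \<circ> s) X + (\<phi> \<circ> s) Y"
      using comb[OF s_sym s_sym, of 1 X 1 Y] by (simp add: s_add)
  next
    fix c X
    show "(\<phi> \<circ> s) (c *\<^sub>R X) = c *\<^sub>R (\<phi> \<circ> s) X"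
      using comb[OF s_sym s_sym, of c X 0 X] by (simp add: s_scale)
  qed
  define Y where "Y = adjoint (\<phi> \<circ> s) 1"
  have Y: "Y \<bullet> X = \<phi> (s X)" for X
    using adjoint_works[OF lin, of X 1] by (simp add: Y_def inner_commute)
  have s_adj: "s Y \<bullet> X = Y \<bullet> s X" for X
  proof -
    have "transpose Y \<bullet> X = Y \<bullet> transpose X"
      unfolding inner_vec_def transpose_def by (simp, rule sum.swap)
    then show ?thesis
      by (simp add: s_def inner_add_left inner_add_right)
  qed
  have ex: "s Y \<in> sym_mats \<and> (\<forall>X\<in>sym_mats. s Y \<bullet> X = \<phi> X)"
    using s_sym by (simp add: s_adj Y s_id)
  have "sym_representer \<phi> \<in> sym_mats \<and> (\<forall>X\<in>sym_mats. sym_representer \<phi> \<bullet> X = \<phi> X)"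
    unfolding sym_representer_def
    by (rule theI[of _ "s Y"], rule ex) (rule sym_representer_unique, use ex in auto)
  then show "sym_representer \<phi> \<in> sym_mats" and "X \<in> sym_mats \<Longrightarrow> sym_representer \<phi> \<bullet> X = \<phi> X"
    by auto
qed

text \<open>
  Vectors of length \<open>N\<close> are functions on \<^typ>\<open>nat\<close> read on \<open>{..<N}\<close>, since the codomains of the maps
  \<open>Q\<^sub>h\<close> have a dimension that depends on \<open>h\<close>. The added 0 only matters for \<open>N = 0\<close>.
\<close>

definition lp_norm :: "ennreal \<Rightarrow> nat \<Rightarrow> (nat \<Rightarrow> real) \<Rightarrow> real" where
  "lp_norm p N z =
     (if p = \<infinity> then Max (insert 0 ((\<lambda>i. \<bar>z i\<bar>) ` {..<N}))
      else (\<Sum>i<N. \<bar>z i\<bar> powr enn2real p) powr (1 / enn2real p))"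

definition conj_exponent :: "ennreal \<Rightarrow> ennreal" where
  "conj_exponent p = (THE q. 1 \<le> q \<and> 1 / p + 1 / q = 1)"

record ('n::finite, 'm::finite, 'h) logdet_problem =
  costC :: "real^'n^'n"
  barrier :: real                                     \<comment> \<open>\<open>\<mu>\<close>\<close>
  weight :: "'h \<Rightarrow> real"                               \<comment> \<open>\<open>\<lambda>\<^sub>h\<close>\<close>
  expo :: "'h \<Rightarrow> ennreal"                              \<comment> \<open>\<open>p\<^sub>h\<close>\<close>
  dimQ :: "'h \<Rightarrow> nat"                                  \<comment> \<open>\<open>n\<^sub>h\<close>\<close>
  opQ :: "'h \<Rightarrow> real^'n^'n \<Rightarrow> nat \<Rightarrow> real"             \<comment> \<open>coordinates of \<open>Q\<^sub>h(X)\<close>\<close>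
  matA :: "'m \<Rightarrow> real^'n^'n"
  rhs :: "real^'m"                                    \<comment> \<open>\<open>b\<close>\<close>

record spg_params =
  eps :: real
  tau :: real
  gamma :: real
  beta :: real
  alpha_min :: real
  alpha_max :: real
  memory :: nat                                       \<comment> \<open>\<open>M\<close>\<close>

type_synonym ('n, 'm, 'h) dual_var = "(real^'m) \<times> ((real^'n^'n)^'h)"

definition opA :: "('n::finite, 'm::finite, 'h) logdet_problem \<Rightarrow> real^'n^'n \<Rightarrow> real^'m" where
  "opA P X = (\<chi> i. matA P i \<bullet> X)"

definition adjA :: "('n::finite, 'm::finite, 'h) logdet_problem \<Rightarrow> real^'m \<Rightarrow> real^'n^'n" where
  "adjA P y = sym_representer (\<lambda>X. opA P X \<bullet> y)"

definition adjQ :: "('n::finite, 'm::finite, 'h) logdet_problem \<Rightarrow> 'h \<Rightarrow> (nat \<Rightarrow> real) \<Rightarrow> real^'n^'n" where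
  "adjQ P h z = sym_representer (\<lambda>X. \<Sum>i<dimQ P h. opQ P h X i * z i)"

definition setS :: "('n::finite, 'm::finite, 'h) logdet_problem \<Rightarrow> 'h \<Rightarrow> (real^'n^'n) set" where
  "setS P h = {adjQ P h z | z. lp_norm (conj_exponent (expo P h)) (dimQ P h) z \<le> weight P h}"

definition opB :: "('n::finite, 'm::finite, 'h::finite) logdet_problem \<Rightarrow> ('n, 'm, 'h) dual_var \<Rightarrow> real^'n^'n" where
  "opB P U = - adjA P (fst U) + (\<Sum>h\<in>UNIV. snd U $ h)"

definition dual_obj :: "('n::finite, 'm::finite, 'h::finite) logdet_problem \<Rightarrow> ('n, 'm, 'h) dual_var \<Rightarrow> real" where
  "dual_obj P U = rhs P \<bullet> fst U + barrier P * ln (det (costC P + opB P U))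
     + real CARD('n) * barrier P - real CARD('n) * barrier P * ln (barrier P)"

text \<open>As \<open>setS P h\<close> consists of symmetric matrices, so do the components of the elements of \<open>setM P\<close>.\<close>

definition setM :: "('n::finite, 'm::finite, 'h::finite) logdet_problem \<Rightarrow> ('n, 'm, 'h) dual_var set" where
  "setM P = {U. \<forall>h. snd U $ h \<in> setS P h}"

definition dual_feasible :: "('n::finite, 'm::finite, 'h::finite) logdet_problem \<Rightarrow> ('n, 'm, 'h) dual_var set" where
  "dual_feasible P = setM P \<inter> {U. pos_definite (costC P + opB P U)}"

definition dual_opt :: "('n::finite, 'm::finite, 'h::finite) logdet_problem \<Rightarrow> real" where
  "dual_opt P = (SUP U\<in>dual_feasible P. dual_obj P U)"

definition primal_of :: "('n::finite, 'm::finite, 'h::finite) logdet_problem \<Rightarrow> ('n, 'm, 'h) dual_var \<Rightarrow> real^'n^'n" where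
  "primal_of P U = barrier P *\<^sub>R matrix_inv (costC P + opB P U)"

definition dual_grad ::
    "('n::finite, 'm::finite, 'h::finite) logdet_problem \<Rightarrow> ('n, 'm, 'h) dual_var \<Rightarrow> ('n, 'm, 'h) dual_var" where
  "dual_grad P U = (rhs P - opA P (primal_of P U), (\<chi> h. primal_of P U))"

text \<open>
  The projection \<^const>\<open>closest_point\<close> is taken in the space of all matrices. It is only applied to
  points with symmetric components, where it agrees with the projection in the dual variable space.
\<close>

definition proj_step ::
    "('n::finite, 'm::finite, 'h::finite) logdet_problem \<Rightarrow> real \<Rightarrow> ('n, 'm, 'h) dual_var \<Rightarrow> ('n, 'm, 'h) dual_var" where
  "proj_step P a U = closest_point (setM P) (U + a *\<^sub>R dual_grad P U) - U"

definition cholesky_factor ::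
    "real^'n::{finite,linorder}^'n::{finite,linorder} \<Rightarrow> real^'n::{finite,linorder}^'n::{finite,linorder} \<Rightarrow> bool" where
  "cholesky_factor X L \<longleftrightarrow>
     (\<forall>i j. i < j \<longrightarrow> L $ i $ j = 0) \<and> (\<forall>i. 0 < L $ i $ i) \<and> L ** transpose L = X"

definition min_eigenvalue :: "real^'n^'n \<Rightarrow> real" where
  "min_eigenvalue X = Min {t. \<exists>v. v \<noteq> 0 \<and> X *v v = t *\<^sub>R v}"

definition spg_stop ::
    "('n::finite, 'm::finite, 'h::finite) logdet_problem \<Rightarrow> spg_params \<Rightarrow> ('n, 'm, 'h) dual_var \<Rightarrow> bool" where
  "spg_stop P R U \<longleftrightarrow> norm (proj_step P 1 U) \<le> eps R"

text \<open>
  In the nonmonotone line search, truncated subtraction on \<^typ>\<open>nat\<close> provides the positive part in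
  the lower end \<open>[k - M + 1]\<^sub>+\<close> of the window.
\<close>

definition line_search_ok ::
    "('n::finite, 'm::finite, 'h::finite) logdet_problem \<Rightarrow> spg_params \<Rightarrow> (nat \<Rightarrow> ('n, 'm, 'h) dual_var) \<Rightarrow> nat
     \<Rightarrow> ('n, 'm, 'h) dual_var \<Rightarrow> real \<Rightarrow> real \<Rightarrow> bool" where
  "line_search_ok P R U k D \<nu> \<sigma> \<longleftrightarrow>
     dual_obj P (U k + (\<sigma> * \<nu>) *\<^sub>R D)
       \<ge> Min ((\<lambda>l. dual_obj P (U l)) ` {k + 1 - memory R..k}) + gamma R * \<sigma> * \<nu> * (dual_grad P (U k) \<bullet> D)"

definition next_alpha ::
    "('n::finite, 'm::finite, 'h::finite) logdet_problem \<Rightarrow> spg_params \<Rightarrow> ('n, 'm, 'h) dual_var \<Rightarrow> ('n, 'm, 'h) dual_var \<Rightarrow> real" where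
  "next_alpha P R U U' =
     (let p = (U' - U) \<bullet> (dual_grad P U' - dual_grad P U) in
      if p \<ge> 0 then alpha_max R
      else min (alpha_max R) (max (alpha_min R) (- (norm (U' - U))\<^sup>2 / p)))"

text \<open>
  \<open>spg_step P R U k a U' a'\<close>: Steps 2 and 3 in iteration \<open>k\<close>, with history \<open>U 0, \<dots>, U k\<close> and current
  step parameter \<open>a\<close>, can produce the next iterate \<open>U'\<close> and the next step parameter \<open>a'\<close>.
\<close>

definition spg_step ::
    "('n::{finite,linorder}, 'm::finite, 'h::finite) logdet_problem \<Rightarrow> spg_params \<Rightarrow> (nat \<Rightarrow> ('n, 'm, 'h) dual_var) \<Rightarrow> nat
     \<Rightarrow> real \<Rightarrow> ('n, 'm, 'h) dual_var \<Rightarrow> real \<Rightarrow> bool" where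
  "spg_step P R U k a U' a' \<longleftrightarrow>
     (\<exists>D L \<theta> \<nu> \<sigma>.
        D = proj_step P a (U k) \<and>
        cholesky_factor (costC P + opB P (U k)) L \<and>
        \<theta> = min_eigenvalue (matrix_inv L ** opB P D ** matrix_inv (transpose L)) \<and>
        \<nu> = (if \<theta> \<ge> 0 then 1 else min 1 (- tau R / \<theta>)) \<and>
        \<sigma> \<in> range (\<lambda>j::nat. beta R ^ j) \<and>
        line_search_ok P R U k D \<nu> \<sigma> \<and>
        (\<forall>s \<in> range (\<lambda>j::nat. beta R ^ j). line_search_ok P R U k D \<nu> s \<longrightarrow> s \<le> \<sigma>) \<and>
        U' = U k + (\<sigma> * \<nu>) *\<^sub>R D \<and>
        a' = next_alpha P R (U k) U')"

text \<open>
  \<open>spg_run P R U \<alpha> N\<close>: the iterates \<open>U k\<close> with \<open>k \<le> N\<close> form a complete run. A finite run ends either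
  because the stopping test holds or because the current iteration cannot be carried out; that the
  latter never happens is therefore part of any claim about all runs. Values of \<open>U\<close> and \<open>\<alpha>\<close> beyond
  \<open>N\<close> are irrelevant.
\<close>

definition spg_run ::
    "('n::{finite,linorder}, 'm::finite, 'h::finite) logdet_problem \<Rightarrow> spg_params \<Rightarrow> (nat \<Rightarrow> ('n, 'm, 'h) dual_var)
     \<Rightarrow> (nat \<Rightarrow> real) \<Rightarrow> enat \<Rightarrow> bool" where
  "spg_run P R U \<alpha> N \<longleftrightarrow>
     U 0 \<in> dual_feasible P \<and> alpha_min R \<le> \<alpha> 0 \<and> \<alpha> 0 \<le> alpha_max R \<and>
     (\<forall>k. enat k < N \<longrightarrow>
        \<not> spg_stop P R (U k) \<and> spg_step P R U k (\<alpha> k) (U (Suc k)) (\<alpha> (Suc k))) \<and>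
     (\<forall>k. N = enat k \<longrightarrow>
        spg_stop P R (U k) \<or> (\<nexists>U' a'. spg_step P R U k (\<alpha> k) U' a'))"

end

theory Submission
  imports Defs
begin

text \<open>
  Concavity enters only through the tangent inequality
  \<open>ln det W \<le> ln det Z + Z\<inverse> \<bullet> (W - Z)\<close>, which a Cholesky factorization reduces to \<open>ln x \<le> x - 1\<close>.
  Used at the new point, together with the resolvent identity for the gradients, it also gives the
  quadratic lower bound on which the line search depends.

  The primal interior point makes the level sets of the dual objective bounded, with \<open>C + B(U)\<close>
  bounded away from singularity. On such a level set, step lengths are bounded below, and the
  projection inequality together with the tangent inequality bounds the optimality gap at \<open>U\<^sup>k\<close> by a
  multiple of \<open>\<parallel>D\<^sup>k\<parallel>\<close>. The minima over the window of the line search increase to a limit, so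
  \<open>D\<close> tends to 0 along the steps into the worst points of the windows; hence the worst values, and with
  them all values, converge to \<open>g\<^sup>*\<close>.
\<close>

section \<open>Symmetric and positive definite matrices\<close>

text \<open>The optimal value is a supremum that is not shown to be attained, and its finiteness is
  itself a consequence of the gap estimate. So the gap at an iterate is measured against every
  feasible \<open>V\<close> with one constant, and the supremum is taken last. Points
  \<open>V\<close> below the level of the iterates need no estimate; all others lie in one bounded
  set.

  The primal interior point X acts through b = A(X): then b \<bullet> y is X \<bullet> A^T(y), and
  up to a bounded contribution of the S_h the objective becomes \<mu> ln det Z - X \<bullet> Z in
  the slack matrix Z = C + B(U). Injectivity of the adjoint of A then recovers a bound on y.

  The gap estimate concerns the point before a step into the worst point of a window, whereas the
  limit is needed at the worst point itself; a Lipschitz bound on the level set carries the estimate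
  across the step. Finally, a finite run in the sense of \<open>spg_run\<close> may also end for
  want of a possible step, so the existence of Cholesky factors and the success of the backtracking
  belong to the claim.\<close>

lemma subspace_sym_mats: "subspace sym_mats"
  by (auto simp: subspace_def sym_mats_def transpose_def vec_eq_iff)

lemma inner_mult_sym_mats: "x \<bullet> (A *v y) = (A *v x) \<bullet> y" if "A \<in> sym_mats"
  using that by (simp add: sym_mats_def flip: dot_lmul_matrix transpose_matrix_vector)

lemma bilinear_matrix_vector_mult: "bilinear ((*v) :: real^'n^'m \<Rightarrow> real^'n \<Rightarrow> real^'m)"
  by (auto simp: bilinear_def linear_iff matrix_vector_right_distrib matrix_vector_mult_add_rdistrib
      matrix_vector_mult_scaleR scaleR_matrix_vector_assoc)

lemma bilinear_matrix_matrix_mult: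
  "bilinear ((**) :: real^'n^'m \<Rightarrow> real^'k^'n \<Rightarrow> real^'k^'m)"
  by (auto simp: bilinear_def linear_iff matrix_matrix_mult_def vec_eq_iff sum.distrib
      distrib_left distrib_right sum_distrib_left mult.assoc mult.left_commute)

lemma bounded_bilinear_matrix_vector_mult:
  "bounded_bilinear ((*v) :: real^'n^'m \<Rightarrow> real^'n \<Rightarrow> real^'m)"
  using bilinear_matrix_vector_mult bilinear_conv_bounded_bilinear by blast

lemma bounded_bilinear_matrix_matrix_mult:
  "bounded_bilinear ((**) :: real^'n^'m \<Rightarrow> real^'k^'n \<Rightarrow> real^'k^'m)"
  using bilinear_matrix_matrix_mult bilinear_conv_bounded_bilinear by blast

lemma inner_matrix_trace: "A \<bullet> B = trace (transpose A ** B)" for A B :: "real^'n^'n"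
  unfolding inner_vec_def trace_def transpose_def matrix_matrix_mult_def
  by (simp, rule sum.swap)

text \<open>With \<open>norm_sq_columns\<close>, a lower bound on the quadratic form of
  \<open>A\<close> can act column by column on a factor \<open>L\<close>, which bounds the pairing
  from below by the squared norm of \<open>L\<close>.\<close>

lemma inner_matrix_mult_transpose: "A \<bullet> (L ** transpose L) = (\<Sum>j\<in>UNIV. column j L \<bullet> (A *v column j L))"
  for A L :: "real^'n^'n"
proof -
  have "A \<bullet> (L ** transpose L) = (\<Sum>i\<in>UNIV. \<Sum>k\<in>UNIV. \<Sum>j\<in>UNIV. A $ i $ k * L $ i $ j * L $ k $ j)"
    by (simp add: inner_vec_def matrix_matrix_mult_def transpose_def sum_distrib_left mult.assoc)
  also have "\<dots> = (\<Sum>i\<in>UNIV. \<Sum>j\<in>UNIV. \<Sum>k\<in>UNIV. A $ i $ k * L $ i $ j * L $ k $ j)"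
    by (rule sum.cong[OF refl], rule sum.swap)
  also have "\<dots> = (\<Sum>j\<in>UNIV. \<Sum>i\<in>UNIV. \<Sum>k\<in>UNIV. A $ i $ k * L $ i $ j * L $ k $ j)"
    by (rule sum.swap)
  also have "\<dots> = (\<Sum>j\<in>UNIV. column j L \<bullet> (A *v column j L))"
    by (simp add: inner_vec_def matrix_vector_mult_def column_def sum_distrib_left ac_simps)
  finally show ?thesis .
qed

lemma norm_sq_columns: "(norm L)\<^sup>2 = (\<Sum>j\<in>UNIV. column j L \<bullet> column j L)" for L :: "real^'n^'n"
  unfolding power2_norm_eq_inner by (simp add: inner_vec_def column_def, rule sum.swap)

section \<open>Positive definiteness, inverses and congruence\<close>

lemma pos_definite_sym: "pos_definite X \<Longrightarrow> X \<in> sym_mats"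
  by (simp add: pos_definite_def)

lemma pos_definite_nonneg: "pos_definite X \<Longrightarrow> 0 \<le> v \<bullet> (X *v v)"
  by (cases "v = 0") (auto simp: pos_definite_def less_imp_le)

lemma pos_definite_invertible:
  assumes "pos_definite X"
  shows "invertible X"
proof -
  have "X *v v = 0 \<Longrightarrow> v = 0" for v
    using assms by (metis inner_zero_right less_irrefl pos_definite_def)
  then show ?thesis
    by (simp add: invertible_left_inverse matrix_left_invertible_ker)
qed

lemma matrix_inv_right: "A ** matrix_inv A = mat 1"
  and matrix_inv_left: "matrix_inv A ** A = mat 1" if "invertible A" for A :: "real^'n^'n"
  using someI_ex[of "\<lambda>A'. A ** A' = mat 1 \<and> A' ** A = mat 1"] that
  by (auto simp: matrix_inv_def invertible_def)

lemma matrix_inv_unique_left: "matrix_inv A = B" if "B ** A = mat 1" for A :: "real^'n^'n"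
proof -
  have "invertible A"
    using that invertible_left_inverse by blast
  then have "B ** (A ** matrix_inv A) = B"
    by (simp add: matrix_inv_right)
  then show ?thesis
    by (simp add: matrix_mul_assoc that)
qed

lemma matrix_inv_transpose: "matrix_inv (transpose A) = transpose (matrix_inv A)"
  if "invertible A" for A :: "real^'n^'n"
  by (rule matrix_inv_unique_left) (metis that matrix_inv_right matrix_transpose_mul transpose_mat)

lemma matrix_inv_sym: "X \<in> sym_mats \<Longrightarrow> invertible X \<Longrightarrow> matrix_inv X \<in> sym_mats"
  for X :: "real^'n^'n"
  using matrix_inv_transpose[of X] by (simp add: sym_mats_def)

lemma pos_definite_congruence:
  fixes X G :: "real^'n^'n"
  assumes X: "pos_definite X" and G: "invertible G"
  shows "pos_definite (G ** X ** transpose G)"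
proof -
  have "G ** X ** transpose G \<in> sym_mats"
    using pos_definite_sym[OF X] by (simp add: sym_mats_def matrix_transpose_mul matrix_mul_assoc)
  moreover have "0 < v \<bullet> (G ** X ** transpose G *v v)" if "v \<noteq> 0" for v
  proof -
    have "matrix_inv (transpose G) *v (transpose G *v v) = v"
      using matrix_inv_left[OF transpose_invertible[OF G]]
      by (simp add: matrix_vector_mul_assoc del: transpose_matrix_vector)
    then have "transpose G *v v \<noteq> 0"
      using that by (metis matrix_vector_mult_0_right)
    moreover have "v \<bullet> (G ** X ** transpose G *v v) = (transpose G *v v) \<bullet> (X *v (transpose G *v v))"
      by (simp add: dot_lmul_matrix flip: matrix_vector_mul_assoc)
    ultimately show ?thesis
      using X by (simp add: pos_definite_def)
  qed
  ultimately show ?thesis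
    by (simp add: pos_definite_def)
qed

subsection \<open>The smallest eigenvalue\<close>

text \<open>A minimizer of the quadratic form on the unit sphere is an eigenvector for the minimum
  \<open>t\<close>, and no eigenvalue is smaller. As \<open>min_eigenvalue\<close> is a
  \<open>Min\<close>, this identifies it only once the set of eigenvalues is known to be
  finite.\<close>

lemma min_eigenvalue_sym:
  fixes A :: "real^'n^'n"
  assumes A: "A \<in> sym_mats"
  shows min_eigenvalue_eigenvector: "\<exists>v. v \<noteq> 0 \<and> A *v v = min_eigenvalue A *\<^sub>R v"
    and min_eigenvalue_le: "min_eigenvalue A * (v \<bullet> v) \<le> v \<bullet> (A *v v)"
proof -
  define S where "S = {t. \<exists>v. v \<noteq> 0 \<and> A *v v = t *\<^sub>R v}"
  have "continuous_on (sphere 0 1) (\<lambda>v. v \<bullet> (A *v v))"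
    by (intro continuous_intros linear_continuous_on_compose[OF continuous_on_id]) simp_all
  moreover have "sphere (0::real^'n) 1 \<noteq> {}" "compact (sphere (0::real^'n) 1)"
    by simp_all
  ultimately obtain u where u: "norm u = 1" and min: "\<And>v. norm v = 1 \<Longrightarrow> u \<bullet> (A *v u) \<le> v \<bullet> (A *v v)"
    using continuous_attains_inf[of "sphere (0::real^'n) 1" "\<lambda>v. v \<bullet> (A *v v)"] by auto
  define t where "t = u \<bullet> (A *v u)"
  have t_le: "t * (v \<bullet> v) \<le> v \<bullet> (A *v v)" for v
  proof (cases "v = 0")
    case False
    then have "t \<le> (v /\<^sub>R norm v) \<bullet> (A *v (v /\<^sub>R norm v))"
      unfolding t_def by (intro min) simp
    also have "\<dots> = v \<bullet> (A *v v) / (norm v)\<^sup>2"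
      by (simp add: matrix_vector_mult_scaleR power2_eq_square divide_inverse)
    finally show ?thesis
      using False by (simp add: field_simps power2_norm_eq_inner)
  qed simp
  define w where "w = A *v u - t *\<^sub>R u"
  have uu: "u \<bullet> u = 1"
    using u by (simp add: norm_eq_1)
  \<comment> \<open>\<open>u\<close> minimises the form of \<open>A - t I\<close>, with value 0; moving in direction \<open>-w\<close> would decrease it.\<close>
  have "w = 0"
  proof (rule ccontr)
    assume "w \<noteq> 0"
    define q where "q = w \<bullet> (A *v w) - t * (w \<bullet> w)"
    have "w \<bullet> w = w \<bullet> (A *v u - t *\<^sub>R u)"
      by (simp only: w_def)
    then have ww: "w \<bullet> w = w \<bullet> (A *v u) - t * (w \<bullet> u)"
      by (simp only: inner_diff_right inner_scaleR_right)
    have pos: "0 < w \<bullet> w"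
      using \<open>w \<noteq> 0\<close> by simp
    have uAw: "u \<bullet> (A *v w) = w \<bullet> (A *v u)"
      using inner_mult_sym_mats[OF A, of u w] by (simp add: inner_commute)
    have quad: "2 * s * (w \<bullet> w) \<le> s * s * q" for s
      unfolding ww
      using t_le[of "u - s *\<^sub>R w"] uAw uu
      by (simp add: matrix_vector_mult_diff_distrib matrix_vector_mult_scaleR inner_diff_left
          inner_diff_right q_def t_def[symmetric] inner_commute[of u w] algebra_simps)
    \<comment> \<open>For positive \<open>s\<close>, \<open>quad\<close> demands
      \<open>2 * (w \<bullet> w) \<le> s * q\<close>. This choice keeps the right side at most
      \<open>w \<bullet> w\<close>; the added 1 covers \<open>q = 0\<close>.\<close>
    define s where "s = (w \<bullet> w) / (\<bar>q\<bar> + 1)"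
    have "0 < s" using pos by (simp add: s_def)
    have "2 * (w \<bullet> w) \<le> s * q"
      using quad[of s] \<open>0 < s\<close> by (simp add: mult.assoc)
    also have "\<dots> \<le> s * (\<bar>q\<bar> + 1)"
      using \<open>0 < s\<close> by (intro mult_left_mono) auto
    also have "\<dots> = w \<bullet> w"
      by (simp add: s_def)
    finally show False using pos by simp
  qed
  then have "t \<in> S"
    using u unfolding S_def w_def by (auto intro!: exI[of _ u])
  \<comment> \<open>Eigenvectors for distinct eigenvalues are orthogonal, and pairwise orthogonal
    sets are finite in finite dimension.\<close>
  have "finite S"
  proof -
    have "\<forall>t\<in>S. \<exists>v. v \<noteq> 0 \<and> A *v v = t *\<^sub>R v"
      by (simp add: S_def)
    then obtain f where f: "\<And>t. t \<in> S \<Longrightarrow> f t \<noteq> 0 \<and> A *v f t = t *\<^sub>R f t"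
      by metis
    have "f r \<bullet> f s = 0" if "r \<in> S" "s \<in> S" "r \<noteq> s" for r s
    proof -
      have "r * (f r \<bullet> f s) = s * (f r \<bullet> f s)"
        using inner_mult_sym_mats[OF A, of "f r" "f s"] f[OF that(1)] f[OF that(2)] by auto
      then show ?thesis
        using that by simp
    qed
    moreover have "inj_on f S"
    proof (rule inj_onI)
      fix r s assume "r \<in> S" "s \<in> S" "f r = f s"
      then have "r *\<^sub>R f r = s *\<^sub>R f r" "f r \<noteq> 0" using f by metis+
      then show "r = s" by simp
    qed
    ultimately have "pairwise orthogonal (f ` S)"
      by (auto simp: pairwise_def orthogonal_def)
    with \<open>inj_on f S\<close> show ?thesis
      by (metis finite_imageD pairwise_orthogonal_imp_finite)
  qed
  have "t \<le> r" if "r \<in> S" for r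
  proof -
    from that obtain v where "v \<noteq> 0" "A *v v = r *\<^sub>R v"
      unfolding S_def by blast
    then show ?thesis
      using t_le[of v] by simp
  qed
  with \<open>finite S\<close> \<open>t \<in> S\<close> have "min_eigenvalue A = t"
    unfolding min_eigenvalue_def S_def[symmetric] by (intro Min_eqI)
  with \<open>t \<in> S\<close> t_le show "\<exists>v. v \<noteq> 0 \<and> A *v v = min_eigenvalue A *\<^sub>R v"
    "min_eigenvalue A * (v \<bullet> v) \<le> v \<bullet> (A *v v)"
    by (auto simp: S_def)
qed

lemma pos_definite_min_eigenvalue:
  assumes "pos_definite A"
  shows "0 < min_eigenvalue A"
proof -
  obtain v where v: "v \<noteq> 0" "A *v v = min_eigenvalue A *\<^sub>R v"
    using min_eigenvalue_eigenvector[OF pos_definite_sym[OF assms]] by blast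
  then have "0 < min_eigenvalue A * (v \<bullet> v)"
    using assms unfolding pos_definite_def by (metis inner_scaleR_right)
  then show ?thesis
    using inner_ge_zero[of v] by (auto simp: zero_less_mult_iff)
qed

subsection \<open>Cholesky factorization and the determinant\<close>

text \<open>
  One column of the factor is split off at a time; the set \<open>S\<close> holds the indices that are left, and
  the remaining matrix is the Schur complement.
\<close>

lemma cholesky_on:
  fixes X :: "real^'n::{finite,linorder}^'n::{finite,linorder}"
  assumes "X \<in> sym_mats" and "\<And>i j. i \<notin> S \<Longrightarrow> X $ i $ j = 0"
    and "\<And>v. v \<noteq> 0 \<Longrightarrow> (\<And>i. i \<notin> S \<Longrightarrow> v $ i = 0) \<Longrightarrow> 0 < v \<bullet> (X *v v)"
  shows "\<exists>L. (\<forall>i j. i < j \<longrightarrow> L $ i $ j = 0) \<and> (\<forall>i\<in>S. 0 < L $ i $ i) \<and>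
           (\<forall>i j. i \<notin> S \<or> j \<notin> S \<longrightarrow> L $ i $ j = 0) \<and> L ** transpose L = X"
  using finite[of S] assms
\<comment> \<open>The least remaining index serves as pivot, so the column split off has no entry
  above the diagonal.\<close>
proof (induction S arbitrary: X rule: finite_linorder_min_induct)
  case empty
  then have "X = 0" by (simp add: vec_eq_iff)
  then show ?case
    by (intro exI[of _ 0]) (simp add: matrix_matrix_mult_def vec_eq_iff)
next
  case (insert m S)
  note supp = insert.prems(2) and pos = insert.prems(3)
  have sym: "X $ i $ j = X $ j $ i" for i j
    using insert.prems(1) by (auto simp: sym_mats_def transpose_def vec_eq_iff)
  define d where "d = X $ m $ m"
  define x where "x = column m X"
  have Xm: "X *v axis m 1 = x"
    by (simp add: x_def matrix_vector_mult_basis)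
  have Xv_m: "axis m 1 \<bullet> (X *v v) = v \<bullet> x" for v
    using inner_mult_sym_mats[OF insert.prems(1), of "axis m 1" v] Xm by (simp add: inner_commute)
  have "0 < axis m 1 \<bullet> (X *v axis m 1)"
    by (rule pos) (auto simp: axis_eq_0_iff, auto simp: axis_def)
  moreover have "axis m 1 \<bullet> (X *v axis m 1) = d"
    unfolding Xm by (simp add: x_def d_def column_def inner_axis')
  ultimately have "0 < d" by simp
  define Y where "Y = (\<chi> i j. X $ i $ j - x $ i * x $ j / d)"
  have Y_sym: "Y \<in> sym_mats"
    using sym by (simp add: sym_mats_def transpose_def vec_eq_iff Y_def mult.commute)
  have Y_supp: "Y $ i $ j = 0" if "i \<notin> S" for i j
  proof (cases "i = m")
    case True
    then show ?thesis
      using \<open>0 < d\<close> sym by (simp add: Y_def x_def d_def column_def)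
  next
    case False
    then have "X $ i $ k = 0" for k using supp that by simp
    then show ?thesis
      by (simp add: Y_def x_def column_def)
  qed
  have Y_quad: "v \<bullet> (Y *v v) = v \<bullet> (X *v v) - (v \<bullet> x)\<^sup>2 / d" for v
  proof -
    have "Y *v v = X *v v - ((v \<bullet> x) / d) *\<^sub>R x"
      by (simp add: vec_eq_iff matrix_vector_mult_def Y_def inner_vec_def algebra_simps
          sum_subtractf sum_divide_distrib sum_distrib_left)
    then show ?thesis
      by (simp add: inner_diff_right power2_eq_square)
  qed
  have Y_pos: "0 < v \<bullet> (Y *v v)" if v: "v \<noteq> 0" "\<And>i. i \<notin> S \<Longrightarrow> v $ i = 0" for v
  proof -
    \<comment> \<open>\<open>u\<close> minimizes the form of \<open>X\<close> among the shifts of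
      \<open>v\<close> along the pivot axis, and the minimum is the form of the Schur complement
      \<open>Y\<close> at \<open>v\<close>. The shift changes only the entry at \<open>m\<close>,
      where \<open>v\<close> vanishes, so \<open>u\<close> is nonzero.\<close>
    define u where "u = v - ((v \<bullet> x) / d) *\<^sub>R axis m 1"
    have "m \<notin> S" using insert.hyps by auto
    obtain i where "v $ i \<noteq> 0" using v(1) by (auto simp: vec_eq_iff)
    then have "i \<noteq> m" "u $ i = v $ i" using v(2) \<open>m \<notin> S\<close> by (auto simp: u_def axis_def)
    then have "u \<noteq> 0" using \<open>v $ i \<noteq> 0\<close> by auto
    then have "0 < u \<bullet> (X *v u)"
      by (rule pos) (auto simp: u_def axis_def v(2))
    also have "u \<bullet> (X *v u) = v \<bullet> (X *v v) - (v \<bullet> x)\<^sup>2 / d"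
      using \<open>axis m 1 \<bullet> (X *v axis m 1) = d\<close> Xv_m[of v] \<open>0 < d\<close>
      by (simp add: u_def matrix_vector_mult_diff_distrib matrix_vector_mult_scaleR inner_diff_left
          inner_diff_right Xm power2_eq_square field_simps)
    finally show ?thesis by (simp add: Y_quad)
  qed
  obtain L where L: "\<forall>i j. i < j \<longrightarrow> L $ i $ j = 0" "\<forall>i\<in>S. 0 < L $ i $ i"
      "\<forall>i j. i \<notin> S \<or> j \<notin> S \<longrightarrow> L $ i $ j = 0" "L ** transpose L = Y"
    using insert.IH[OF Y_sym Y_supp Y_pos] by blast
  define K where "K = (\<chi> i j. if j = m then x $ i / sqrt d else L $ i $ j)"
  have mS: "m \<notin> S" using insert.hyps by auto
  have x0: "x $ i = 0" if "i \<notin> insert m S" for i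
    using supp that by (simp add: x_def column_def)
  have "K ** transpose K = X"
  proof -
    have "(\<Sum>k\<in>UNIV. K $ i $ k * K $ j $ k) = X $ i $ j" for i j
    proof -
      have "(\<Sum>k\<in>UNIV. K $ i $ k * K $ j $ k) = K $ i $ m * K $ j $ m + (\<Sum>k\<in>UNIV - {m}. K $ i $ k * K $ j $ k)"
        by (rule sum.remove) auto
      also have "(\<Sum>k\<in>UNIV - {m}. K $ i $ k * K $ j $ k) = (\<Sum>k\<in>UNIV. L $ i $ k * L $ j $ k)"
        by (rule sum.mono_neutral_cong_left) (use L(3) mS in \<open>auto simp: K_def\<close>)
      also have "\<dots> = Y $ i $ j"
        by (simp add: matrix_matrix_mult_def transpose_def flip: L(4))
      finally show ?thesis
        using \<open>0 < d\<close> by (simp add: K_def Y_def)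
    qed
    then show ?thesis
      by (simp add: vec_eq_iff matrix_matrix_mult_def transpose_def)
  qed
  moreover have "0 < K $ i $ i" if "i \<in> insert m S" for i
    using that L(2) \<open>0 < d\<close> mS by (auto simp: K_def x_def d_def column_def)
  moreover have "K $ i $ j = 0" if "i < j" for i j
  proof (cases "j = m")
    case True
    with that have "i \<notin> insert m S" using insert.hyps by auto
    then show ?thesis using x0 True by (simp add: K_def)
  qed (use L(1) that in \<open>simp add: K_def\<close>)
  moreover have "K $ i $ j = 0" if "i \<notin> insert m S \<or> j \<notin> insert m S" for i j
    using that x0 L(3) by (auto simp: K_def)
  ultimately show ?case by blast
qed

lemma cholesky_factor_exists:
  assumes "pos_definite X"
  shows "\<exists>L. cholesky_factor X L"
  using cholesky_on[of X UNIV] assms by (auto simp: cholesky_factor_def pos_definite_def)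

text \<open>A permutation other than the identity sends the least index that it moves to a larger
  one, so its product contains an entry above the diagonal.\<close>

lemma det_lower_triangular:
  fixes A :: "'a::comm_ring_1^'n::{finite,linorder}^'n::{finite,linorder}"
  assumes "\<And>i j. i < j \<Longrightarrow> A $ i $ j = 0"
  shows "det A = (\<Prod>i\<in>UNIV. A $ i $ i)"
proof -
  have zero: "(\<Prod>i\<in>UNIV. A $ i $ p i) = 0" if p: "p permutes UNIV" "p \<noteq> id" for p
  proof -
    define D where "D = {i. p i \<noteq> i}"
    have "D \<noteq> {}" using p(2) by (auto simp: D_def)
    define i where "i = Min D"
    have "i \<in> D" and least: "\<And>j. j \<in> D \<Longrightarrow> i \<le> j"
      using \<open>D \<noteq> {}\<close> by (simp_all add: i_def)
    have "p (p i) \<noteq> p i"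
      using \<open>i \<in> D\<close> permutes_inj[OF p(1)] by (auto simp: D_def dest: injD)
    then have "i < p i"
      using least[of "p i"] \<open>i \<in> D\<close> by (auto simp: D_def)
    then have "A $ i $ p i = 0" by (rule assms)
    then show ?thesis by (intro prod_zero) auto
  qed
  have "det A = (\<Sum>p\<in>{id}. of_int (sign p) * (\<Prod>i\<in>UNIV. A $ i $ p i))"
    unfolding det_def
    by (rule sum.mono_neutral_right) (auto simp: finite_permutations permutes_id zero)
  then show ?thesis by (simp add: sign_id)
qed

lemma cholesky_factor_det:
  assumes "cholesky_factor X L"
  shows "det X = (\<Prod>i\<in>UNIV. L $ i $ i)\<^sup>2" and "0 < (\<Prod>i\<in>UNIV. L $ i $ i)" and "det L \<noteq> 0"
proof -
  have L: "det L = (\<Prod>i\<in>UNIV. L $ i $ i)" "0 < (\<Prod>i\<in>UNIV. L $ i $ i)" "X = L ** transpose L"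
    using assms by (auto simp: cholesky_factor_def intro!: det_lower_triangular prod_pos)
  then show "det X = (\<Prod>i\<in>UNIV. L $ i $ i)\<^sup>2" "0 < (\<Prod>i\<in>UNIV. L $ i $ i)" "det L \<noteq> 0"
    by (simp_all add: det_mul power2_eq_square del: prod_zero_iff)
qed

lemma cholesky_factor_invertible: "cholesky_factor X L \<Longrightarrow> invertible L"
  using cholesky_factor_det(3) invertible_det_nz by blast

lemma pos_definite_det_pos: "pos_definite X \<Longrightarrow> 0 < det X"
  for X :: "real^'n::{finite,linorder}^'n::{finite,linorder}"
  using cholesky_factor_exists[of X] by (auto simp: cholesky_factor_def less_imp_neq[THEN not_sym] cholesky_factor_det(1))

text \<open>The tangent inequality at the identity. The determinant sees only the diagonal of the
  Cholesky factor, while a diagonal entry of \<open>X\<close> is the squared norm of a whole row of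
  it.\<close>

lemma ln_det_le_trace:
  fixes X :: "real^'n::{finite,linorder}^'n::{finite,linorder}"
  assumes "pos_definite X"
  shows "ln (det X) \<le> trace X - real CARD('n)"
proof -
  obtain L where L: "cholesky_factor X L"
    using cholesky_factor_exists[OF assms] by blast
  then have pos: "0 < L $ i $ i" for i by (simp add: cholesky_factor_def)
  have "ln (det X) = ln (\<Prod>i\<in>UNIV. (L $ i $ i)\<^sup>2)"
    by (simp add: cholesky_factor_det(1)[OF L] prod_power_distrib)
  also have "\<dots> = (\<Sum>i\<in>UNIV. ln ((L $ i $ i)\<^sup>2))"
    using pos by (intro ln_prod) (auto simp: order_less_imp_not_eq2)
  also have "\<dots> \<le> (\<Sum>i\<in>UNIV. (L $ i $ i)\<^sup>2 - 1)"
    using pos by (intro sum_mono ln_le_minus_one) (rule zero_less_power)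
  also have "\<dots> \<le> (\<Sum>i\<in>UNIV. X $ i $ i - 1)"
  proof (intro sum_mono diff_right_mono)
    fix i
    have "X $ i $ i = (\<Sum>k\<in>UNIV. (L $ i $ k)\<^sup>2)"
      using L by (auto simp: cholesky_factor_def matrix_matrix_mult_def transpose_def power2_eq_square)
    then show "(L $ i $ i)\<^sup>2 \<le> X $ i $ i"
      using member_le_sum[of i UNIV "\<lambda>k. (L $ i $ k)\<^sup>2"] by simp
  qed
  also have "\<dots> = trace X - real CARD('n)"
    by (simp add: trace_def sum_subtractf)
  finally show ?thesis .
qed

text \<open>Concavity of \<open>ln det\<close>: by congruence with a Cholesky factor of \<open>Z\<close> it reduces to \<open>Z = I\<close>.\<close>

lemma ln_det_tangent:
  fixes Z W :: "real^'n::{finite,linorder}^'n::{finite,linorder}"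
  assumes Z: "pos_definite Z" and W: "pos_definite W"
  shows "ln (det W) \<le> ln (det Z) + matrix_inv Z \<bullet> (W - Z)"
proof -
  obtain L where L: "cholesky_factor Z L"
    using cholesky_factor_exists[OF Z] by blast
  then have LL: "Z = L ** transpose L" by (simp add: cholesky_factor_def)
  define G where "G = matrix_inv L"
  have LG: "L ** G = mat 1" and GL: "G ** L = mat 1"
    using cholesky_factor_invertible[OF L] by (simp_all add: G_def matrix_inv_left matrix_inv_right)
  have "invertible G" using LG GL by (auto simp: invertible_def)
  have "transpose G ** transpose L = mat 1"
    using LG by (simp flip: matrix_transpose_mul)
  then have "transpose G ** (G ** L) ** transpose L = mat 1"
    by (simp add: GL)
  then have Zinv: "matrix_inv Z = transpose G ** G"
    by (intro matrix_inv_unique_left) (simp add: LL matrix_mul_assoc)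
  \<comment> \<open>By cyclicity of the trace, pairing with the inverse of \<open>Z\<close> becomes
    a trace after the congruence by \<open>G\<close> that sends \<open>Z\<close> to the
    identity.\<close>
  have inner: "matrix_inv Z \<bullet> V = trace (G ** V ** transpose G)" for V
  proof -
    have "matrix_inv Z \<bullet> V = trace (transpose G ** (G ** V))"
      by (simp add: Zinv inner_matrix_trace matrix_transpose_mul matrix_mul_assoc)
    also have "\<dots> = trace (G ** V ** transpose G)"
      by (rule trace_mul_sym)
    finally show ?thesis .
  qed
  have "G ** Z ** transpose G = (G ** L) ** transpose (G ** L)"
    by (simp add: LL matrix_transpose_mul matrix_mul_assoc)
  then have GZ: "G ** Z ** transpose G = mat 1"
    by (simp add: GL)
  have detG: "det G * det G * det Z = 1"
    using arg_cong[OF GZ, of det] by (simp add: det_mul ac_simps)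
  have "ln (det (G ** W ** transpose G)) \<le> trace (G ** W ** transpose G) - real CARD('n)"
    by (intro ln_det_le_trace pos_definite_congruence W \<open>invertible G\<close>)
  also have "det (G ** W ** transpose G) = det W / det Z"
    using detG pos_definite_det_pos[OF Z] by (simp add: det_mul field_simps)
  also have "ln \<dots> = ln (det W) - ln (det Z)"
    by (intro ln_divide_pos pos_definite_det_pos Z W)
  also have "trace (G ** W ** transpose G) - real CARD('n) = matrix_inv Z \<bullet> (W - Z)"
    using inner[of W] inner[of Z] GZ by (simp add: inner_diff_right trace_I)
  finally show ?thesis by simp
qed

section \<open>Bounds on inverses and level sets of the log-determinant\<close>

lemma norm_transpose: "norm (transpose A) = norm A" for A :: "real^'n^'m"
proof -
  have "transpose A \<bullet> transpose A = A \<bullet> A"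
    unfolding inner_vec_def transpose_def by (simp, rule sum.swap)
  then show ?thesis
    by (simp add: norm_eq_sqrt_inner)
qed

text \<open>Column \<open>j\<close> of the inverse solves \<open>Z *v w = axis j 1\<close>; testing
  the lower bound with this \<open>w\<close> gives
  \<open>\<eta> * (norm w)\<^sup>2 \<le> norm w\<close>. The square root counts the columns.\<close>

lemma norm_matrix_inv_le:
  fixes Z :: "real^'n^'n"
  assumes Z: "invertible Z" and "0 < \<eta>" and bnd: "\<And>v. \<eta> * (v \<bullet> v) \<le> v \<bullet> (Z *v v)"
  shows "norm (matrix_inv Z) \<le> sqrt (real CARD('n)) / \<eta>"
proof -
  have col: "norm (column j (matrix_inv Z)) \<le> 1 / \<eta>" for j
  proof -
    define w where "w = column j (matrix_inv Z)"
    have "Z *v w = axis j 1"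
      unfolding w_def matrix_vector_mult_basis[symmetric]
      by (simp add: matrix_vector_mul_assoc matrix_inv_right[OF Z])
    then have "\<eta> * (norm w)\<^sup>2 \<le> w \<bullet> axis j 1"
      using bnd[of w] by (simp add: power2_norm_eq_inner)
    also have "\<dots> \<le> norm w"
      using norm_cauchy_schwarz[of w "axis j 1"] by simp
    finally have "\<eta> * norm w \<le> 1"
      by (cases "w = 0") (auto simp: power2_eq_square)
    with \<open>0 < \<eta>\<close> show ?thesis
      by (simp add: w_def field_simps)
  qed
  have "(norm (matrix_inv Z))\<^sup>2 \<le> (\<Sum>j\<in>(UNIV::'n set). (1 / \<eta>)\<^sup>2)"
    unfolding norm_sq_columns
    by (intro sum_mono) (metis col norm_ge_zero power2_norm_eq_inner power_mono)
  also have "\<dots> = (sqrt (real CARD('n)) / \<eta>)\<^sup>2"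
    by (simp add: power_divide)
  finally show ?thesis
    using \<open>0 < \<eta>\<close> by (intro power2_le_imp_le[of "norm (matrix_inv Z)"]) auto
qed

lemma pos_definite_matrix_inv:
  fixes X :: "real^'n^'n"
  assumes "pos_definite X"
  shows "pos_definite (matrix_inv X)"
proof -
  note inv = pos_definite_invertible[OF assms]
  have "transpose (matrix_inv X) = matrix_inv X"
    using matrix_inv_sym[OF pos_definite_sym[OF assms] inv] by (simp add: sym_mats_def)
  moreover have "invertible (matrix_inv X)"
    unfolding invertible_def using matrix_inv_left[OF inv] matrix_inv_right[OF inv] by blast
  ultimately show ?thesis
    using pos_definite_congruence[OF assms, of "matrix_inv X"] by (simp add: matrix_inv_left[OF inv])
qed

lemma pos_definite_scaleR: "0 < c \<Longrightarrow> pos_definite X \<Longrightarrow> pos_definite (c *\<^sub>R X)"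
  by (simp add: pos_definite_def subspace_scale[OF subspace_sym_mats] flip: scaleR_matrix_vector_assoc)

lemma continuous_on_det: "continuous_on S (det :: real^'n^'n \<Rightarrow> real)"
  unfolding det_def by (intro continuous_intros)

text \<open>
  The log-determinant is dominated by any positive multiple of \<open>X \<bullet> Z\<close>, so on the level set \<open>Z\<close> is
  bounded and \<open>det Z\<close> is bounded away from 0.
\<close>

lemma log_det_level_set:
  fixes X :: "real^'n::{finite,linorder}^'n::{finite,linorder}"
  assumes X: "pos_definite X" and "0 < \<mu>"
  obtains \<eta> T where "0 < \<eta>"
    and "\<And>Z. pos_definite Z \<Longrightarrow> c \<le> \<mu> * ln (det Z) - X \<bullet> Z \<Longrightarrow> norm Z \<le> T"
    and "\<And>Z v. pos_definite Z \<Longrightarrow> c \<le> \<mu> * ln (det Z) - X \<bullet> Z \<Longrightarrow> \<eta> * (v \<bullet> v) \<le> v \<bullet> (Z *v v)"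
proof -
  obtain K where "0 < K" and K: "\<And>(A :: real^'n::{finite,linorder}^'n::{finite,linorder}) (B :: real^'n::{finite,linorder}^'n::{finite,linorder}). norm (A ** B) \<le> norm A * norm B * K"
    using bounded_bilinear.pos_bounded[OF bounded_bilinear_matrix_matrix_mult] by blast
  define \<xi> where "\<xi> = min_eigenvalue X"
  have "0 < \<xi>" using pos_definite_min_eigenvalue[OF X] by (simp add: \<xi>_def)
  \<comment> \<open>For \<open>Z = L ** transpose L\<close>, the pairing is at least
    \<open>\<xi>\<close> times the squared norm of \<open>L\<close>, which in turn dominates
    \<open>norm Z / K\<close>.\<close>
  have lower: "\<xi> / K * norm Z \<le> X \<bullet> Z" if Z: "pos_definite Z" for Z
  proof -
    obtain L where "cholesky_factor Z L"
      using cholesky_factor_exists[OF Z] by blast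
    then have L: "Z = L ** transpose L"
      by (simp add: cholesky_factor_def)
    have "norm Z \<le> (norm L)\<^sup>2 * K"
      using K[of L "transpose L"] by (simp add: L norm_transpose power2_eq_square)
    then have "\<xi> / K * norm Z \<le> \<xi> * (norm L)\<^sup>2"
      using \<open>0 < K\<close> \<open>0 < \<xi>\<close> by (simp add: field_simps)
    also have "\<dots> \<le> X \<bullet> Z"
      unfolding L inner_matrix_mult_transpose norm_sq_columns sum_distrib_left \<xi>_def
      by (intro sum_mono min_eigenvalue_le pos_definite_sym X)
    finally show ?thesis .
  qed
  \<comment> \<open>The tangent of the log-determinant at the inverse of
    \<open>X / (2 * \<mu>)\<close> has a slope that uses up only half of
    \<open>X \<bullet> Z\<close>; the other half remains to bound \<open>Z\<close>.\<close>
  define W where "W = (1 / (2 * \<mu>)) *\<^sub>R X"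
  define Y where "Y = matrix_inv W"
  have W: "pos_definite W"
    using \<open>0 < \<mu>\<close> X by (simp add: W_def pos_definite_scaleR)
  have Y: "pos_definite Y" "matrix_inv Y = W"
    using pos_definite_matrix_inv[OF W] matrix_inv_right[OF pos_definite_invertible[OF W]]
    by (simp_all add: Y_def matrix_inv_unique_left)
  define T where "T = 2 * K * (\<mu> * ln (det Y) - (X \<bullet> Y) / 2 - c) / \<xi>"
  have T: "norm Z \<le> T" if Z: "pos_definite Z" and c: "c \<le> \<mu> * ln (det Z) - X \<bullet> Z" for Z
  proof -
    have "\<mu> * ln (det Z) \<le> \<mu> * (ln (det Y) + W \<bullet> (Z - Y))"
      using ln_det_tangent[OF Y(1) Z] \<open>0 < \<mu>\<close> by (simp add: Y(2))
    also have "\<dots> = \<mu> * ln (det Y) + (X \<bullet> Z) / 2 - (X \<bullet> Y) / 2"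
      using \<open>0 < \<mu>\<close> by (simp add: W_def inner_diff_right field_simps)
    finally have "X \<bullet> Z \<le> 2 * (\<mu> * ln (det Y) - (X \<bullet> Y) / 2 - c)"
      using c by (simp add: algebra_simps)
    with lower[OF Z] have "\<xi> / K * norm Z \<le> 2 * (\<mu> * ln (det Y) - (X \<bullet> Y) / 2 - c)"
      by (rule order_trans)
    then show ?thesis
      using \<open>0 < K\<close> \<open>0 < \<xi>\<close> by (simp add: T_def field_simps)
  qed
  define \<delta> where "\<delta> = exp (c / \<mu>)"
  have "0 < \<delta>" by (simp add: \<delta>_def)
  have \<delta>: "\<delta> \<le> det Z" if Z: "pos_definite Z" and c: "c \<le> \<mu> * ln (det Z) - X \<bullet> Z" for Z
  proof -
    have "0 \<le> X \<bullet> Z"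
      using lower[OF Z] \<open>0 < K\<close> \<open>0 < \<xi>\<close> by (auto intro: order_trans[rotated])
    then have "c / \<mu> \<le> ln (det Z)"
      using c \<open>0 < \<mu>\<close> by (simp add: field_simps)
    then show ?thesis
      unfolding \<delta>_def using pos_definite_det_pos[OF Z] by (simp add: ln_ge_iff)
  qed
  \<comment> \<open>Strict definiteness is not a closed condition. Semidefiniteness together with
    \<open>\<delta> \<le> det Z\<close> is closed, so \<open>\<Omega>\<close> is compact, and it
    still forces definiteness. Then \<open>\<eta>\<close> is the minimum of the form over
    \<open>\<Omega>\<close> and the unit sphere.\<close>
  define \<Omega> where "\<Omega> = sym_mats \<inter> (\<Inter>v. {Z. 0 \<le> v \<bullet> (Z *v v)}) \<inter> {Z. \<delta> \<le> det Z} \<inter> cball (0::real^'n::{finite,linorder}^'n::{finite,linorder}) T"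
  have form: "continuous_on S (\<lambda>p. snd p \<bullet> (fst p *v snd p))" for S :: "((real^'n::{finite,linorder}^'n::{finite,linorder}) \<times> (real^'n::{finite,linorder})) set"
    by (intro continuous_intros bounded_bilinear.continuous_on[OF bounded_bilinear_matrix_vector_mult])
  have "closed {Z. 0 \<le> v \<bullet> (Z *v v)}" for v :: "real^'n::{finite,linorder}"
    by (intro closed_Collect_le continuous_intros bounded_bilinear.continuous_on[OF bounded_bilinear_matrix_vector_mult])
  moreover have "closed {Z :: real^'n::{finite,linorder}^'n::{finite,linorder}. \<delta> \<le> det Z}"
    by (intro closed_Collect_le continuous_on_det continuous_intros)
  ultimately have "compact \<Omega>"
    unfolding \<Omega>_def
    by (intro closed_Int_compact closed_Int closed_INT ballI compact_cball
        closed_subspace[OF subspace_sym_mats])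
  then have comp: "compact (\<Omega> \<times> sphere (0::real^'n::{finite,linorder}) 1)"
    by (intro compact_Times) auto
  have in\<Omega>: "Z \<in> \<Omega>" if "pos_definite Z" and "c \<le> \<mu> * ln (det Z) - X \<bullet> Z" for Z
    using that T \<delta> by (auto simp: \<Omega>_def pos_definite_sym pos_definite_nonneg)
  have pos\<Omega>: "0 < v \<bullet> (Z *v v)" if Z: "Z \<in> \<Omega>" and "v \<noteq> 0" for Z v
  proof -
    have sym: "Z \<in> sym_mats" and "invertible Z"
      using Z \<open>0 < \<delta>\<close> by (auto simp: \<Omega>_def invertible_det_nz)
    obtain u where u: "u \<noteq> 0" "Z *v u = min_eigenvalue Z *\<^sub>R u"
      using min_eigenvalue_eigenvector[OF sym] by blast
    have "0 \<le> u \<bullet> (Z *v u)" using Z by (simp add: \<Omega>_def)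
    then have "0 \<le> min_eigenvalue Z"
      using u inner_ge_zero[of u] by (auto simp: zero_le_mult_iff)
    moreover have "min_eigenvalue Z \<noteq> 0"
      using u \<open>invertible Z\<close> by (metis invertible_left_inverse matrix_left_invertible_ker scaleR_zero_left)
    ultimately have "0 < min_eigenvalue Z * (v \<bullet> v)"
      using \<open>v \<noteq> 0\<close> by simp
    then show ?thesis
      using min_eigenvalue_le[OF sym, of v] by linarith
  qed
  have "\<exists>\<eta>>0. \<forall>Z\<in>\<Omega>. \<forall>v. \<eta> * (v \<bullet> v) \<le> v \<bullet> (Z *v v)"
  proof (cases "\<Omega> = {}")
    case True
    then show ?thesis by (auto intro: exI[of _ 1])
  next
    case False
    then have "\<Omega> \<times> sphere (0::real^'n::{finite,linorder}) 1 \<noteq> {}" by auto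
    then obtain p where p: "p \<in> \<Omega> \<times> sphere 0 1"
      and min: "\<And>q. q \<in> \<Omega> \<times> sphere 0 1 \<Longrightarrow> snd p \<bullet> (fst p *v snd p) \<le> snd q \<bullet> (fst q *v snd q)"
      using continuous_attains_inf[OF comp _ form] by blast
    define \<eta> where "\<eta> = snd p \<bullet> (fst p *v snd p)"
    have "snd p \<noteq> 0" using p by auto
    then have "0 < \<eta>"
      unfolding \<eta>_def using p by (intro pos\<Omega>) auto
    moreover have "\<eta> * (v \<bullet> v) \<le> v \<bullet> (Z *v v)" if "Z \<in> \<Omega>" for Z v
    proof (cases "v = 0")
      case False
      then have "\<eta> \<le> (v /\<^sub>R norm v) \<bullet> (Z *v (v /\<^sub>R norm v))"
        using min[of "(Z, v /\<^sub>R norm v)"] that by (simp add: \<eta>_def)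
      also have "\<dots> = v \<bullet> (Z *v v) / (norm v)\<^sup>2"
        by (simp add: matrix_vector_mult_scaleR power2_eq_square divide_inverse)
      finally show ?thesis
        using False by (simp add: field_simps power2_norm_eq_inner)
    qed simp
    ultimately show ?thesis by blast
  qed
  then show thesis
    using that T in\<Omega> by blast
qed

section \<open>Balls of the \<open>p\<close>-norms\<close>

lemma ennreal_inverse_le_1_iff: "inverse x \<le> 1 \<longleftrightarrow> 1 \<le> x" for x :: ennreal
proof (cases x)
  case (real r)
  show ?thesis
  proof (cases "r = 0")
    case False
    with real have "0 < r" by simp
    with real show ?thesis
      by (simp add: inverse_ennreal ennreal_le_1 ennreal_ge_1 inverse_le_1_iff)
  qed (use real in \<open>auto simp: top_unique\<close>)
qed simp

lemma ennreal_inverse_inverse: "inverse (inverse x) = x" for x :: ennreal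
proof (cases x)
  case (real r)
  show ?thesis
    by (cases "r = 0") (use real in \<open>auto simp: inverse_ennreal\<close>)
qed simp

text \<open>\<open>conj_exponent\<close> is a definite description, so the bound requires existence
  and uniqueness of the conjugate. Inversion on \<open>ennreal\<close> is an involution, which lets
  the equation be solved for \<open>inverse q\<close>; the exponents 1 and \<infinity> are then no
  special cases.\<close>

lemma conj_exponent_ge_1:
  assumes "1 \<le> p"
  shows "1 \<le> conj_exponent p"
proof -
  have p: "inverse p \<le> 1"
    using assms by (simp add: ennreal_inverse_le_1_iff)
  define q where "q = inverse (1 - inverse p)"
  have q: "inverse q = 1 - inverse p"
    by (simp add: q_def ennreal_inverse_inverse)
  have eq: "1 / p + 1 / r = inverse p + inverse r" for r
    by (simp only: divide_ennreal_def mult_1)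
  have pq: "inverse p + inverse q = 1"
    unfolding q by (rule add_diff_inverse_ennreal[OF p])
  have unique: "r = q" if "1 / p + 1 / r = 1" for r
  proof -
    have "inverse p + inverse r = inverse p + inverse q"
      using that unfolding eq pq .
    moreover have "inverse p \<noteq> top"
      using p by (auto simp: top_unique)
    ultimately have "inverse r = inverse q"
      by (auto simp: ennreal_add_left_cancel)
    then have "inverse (inverse r) = inverse (inverse q)"
      by (rule arg_cong)
    then show ?thesis
      by (simp only: ennreal_inverse_inverse)
  qed
  have "1 \<le> q"
    unfolding ennreal_inverse_le_1_iff[symmetric] q by (rule diff_le_self_ennreal)
  have "conj_exponent p = q"
    unfolding conj_exponent_def
  proof (rule the_equality)
    show "1 \<le> q \<and> 1 / p + 1 / q = 1"
      unfolding eq pq using \<open>1 \<le> q\<close> by simp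
  qed (use unique in blast)
  with \<open>1 \<le> q\<close> show ?thesis by simp
qed

text \<open>Convexity on the positive reals extends to 0 by \<open>w powr r \<le> w\<close> for
  \<open>w\<close> between 0 and 1; monotonicity on the nonnegative reals carries it through the
  absolute value.\<close>

lemma convex_on_abs_powr:
  assumes "1 \<le> r"
  shows "convex_on UNIV (\<lambda>x::real. \<bar>x\<bar> powr r)"
proof -
  have nonneg: "(u * x + v * y) powr r \<le> u * x powr r + v * y powr r"
    if "0 \<le> x" "0 \<le> y" "0 \<le> u" "0 \<le> v" "u + v = 1" for x y u v :: real
  proof -
    have scale: "(w * z) powr r \<le> w * z powr r" if "0 \<le> w" "w \<le> 1" "0 \<le> z" for w z :: real
      using that assms powr_mono'[of 1 r w]
      by (auto simp: powr_mult intro: mult_right_mono)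
    show ?thesis
    proof (cases "x = 0 \<or> y = 0")
      case True
      then show ?thesis using scale[of v y] scale[of u x] that by auto
    next
      case False
      then show ?thesis
        using convex_onD[OF powr_convex[OF assms], of v x y] that by (simp add: eq_diff_eq[symmetric])
    qed
  qed
  show ?thesis
  proof (rule convex_onI)
    fix t x y :: real assume t: "0 < t" "t < 1"
    have "\<bar>(1 - t) *\<^sub>R x + t *\<^sub>R y\<bar> \<le> (1 - t) * \<bar>x\<bar> + t * \<bar>y\<bar>"
      using t abs_triangle_ineq[of "(1 - t) * x" "t * y"] by (simp add: abs_mult)
    then have "\<bar>(1 - t) *\<^sub>R x + t *\<^sub>R y\<bar> powr r \<le> ((1 - t) * \<bar>x\<bar> + t * \<bar>y\<bar>) powr r"
      using assms by (intro powr_mono2) auto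
    also have "\<dots> \<le> (1 - t) * \<bar>x\<bar> powr r + t * \<bar>y\<bar> powr r"
      using t by (intro nonneg) auto
    finally show "\<bar>(1 - t) *\<^sub>R x + t *\<^sub>R y\<bar> powr r \<le> (1 - t) * \<bar>x\<bar> powr r + t * \<bar>y\<bar> powr r" .
  qed simp
qed

lemma lp_norm_top_le_iff: "lp_norm top N z \<le> w \<longleftrightarrow> 0 \<le> w \<and> (\<forall>i<N. \<bar>z i\<bar> \<le> w)"
  by (auto simp: lp_norm_def)

text \<open>Without the outer root, the ball is a sublevel set of a sum of powers. Its convexity and
  closedness follow from those of the summands, with no appeal to Minkowski's inequality.\<close>

lemma lp_norm_finite_le_iff:
  assumes "1 \<le> p" "p \<noteq> \<infinity>" "0 \<le> w"
  shows "lp_norm p N z \<le> w \<longleftrightarrow> (\<Sum>i<N. \<bar>z i\<bar> powr enn2real p) \<le> w powr enn2real p"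
proof -
  have r: "1 \<le> enn2real p"
    using assms by (metis enn2real_mono enn2real_1 ennreal_top_neq_one infinity_ennreal_def top.not_eq_extremum)
  define s where "s = (\<Sum>i<N. \<bar>z i\<bar> powr enn2real p)"
  have "0 \<le> s" by (auto simp: s_def intro: sum_nonneg)
  have "s powr (1 / enn2real p) \<le> w \<longleftrightarrow> s \<le> w powr enn2real p"
  proof
    assume "s powr (1 / enn2real p) \<le> w"
    then have "(s powr (1 / enn2real p)) powr enn2real p \<le> w powr enn2real p"
      using r by (intro powr_mono2) auto
    then show "s \<le> w powr enn2real p"
      using r \<open>0 \<le> s\<close> by (simp add: powr_powr)
  next
    assume "s \<le> w powr enn2real p"
    then have "s powr (1 / enn2real p) \<le> (w powr enn2real p) powr (1 / enn2real p)"
      using r \<open>0 \<le> s\<close> by (intro powr_mono2) auto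
    then show "s powr (1 / enn2real p) \<le> w"
      using r assms(3) by (simp add: powr_powr)
  qed
  then show ?thesis
    using assms(2) by (simp add: lp_norm_def s_def)
qed

lemma lp_norm_coord_le:
  assumes "1 \<le> p" "0 \<le> w" "lp_norm p N z \<le> w" "i < N"
  shows "\<bar>z i\<bar> \<le> w"
proof (cases "p = \<infinity>")
  case True
  then show ?thesis using assms by (simp add: lp_norm_top_le_iff)
next
  case False
  have "\<bar>z i\<bar> powr enn2real p \<le> (\<Sum>i<N. \<bar>z i\<bar> powr enn2real p)"
    using assms(4) by (intro member_le_sum) auto
  also have "\<dots> \<le> w powr enn2real p"
    using assms False by (simp add: lp_norm_finite_le_iff)
  finally have le: "\<bar>z i\<bar> powr enn2real p \<le> w powr enn2real p" .
  have "0 < enn2real p"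
    using assms(1) False by (auto simp: enn2real_positive_iff top.not_eq_extremum intro: less_le_trans[OF ennreal_zero_less_one])
  show ?thesis
  proof (rule ccontr)
    assume "\<not> \<bar>z i\<bar> \<le> w"
    then have "w powr enn2real p < \<bar>z i\<bar> powr enn2real p"
      using assms(2) \<open>0 < enn2real p\<close> by (intro powr_less_mono2) auto
    with le show False by simp
  qed
qed

lemma lp_norm_convex:
  assumes "1 \<le> p" "0 \<le> w" "lp_norm p N x \<le> w" "lp_norm p N y \<le> w" "0 \<le> u" "0 \<le> v" "u + v = 1"
  shows "lp_norm p N (\<lambda>i. u * x i + v * y i) \<le> w"
proof (cases "p = \<infinity>")
  case True
  have "\<bar>u * x i + v * y i\<bar> \<le> w" if "i < N" for i
  proof -
    have "\<bar>u * x i + v * y i\<bar> \<le> u * \<bar>x i\<bar> + v * \<bar>y i\<bar>"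
      using assms(5,6) abs_triangle_ineq[of "u * x i" "v * y i"] by (simp add: abs_mult)
    also have "\<dots> \<le> u * w + v * w"
      using assms that by (intro add_mono mult_left_mono) (auto intro: lp_norm_coord_le)
    also have "\<dots> = w" using assms(7) by (simp flip: distrib_right)
    finally show ?thesis .
  qed
  then show ?thesis using True assms by (simp add: lp_norm_top_le_iff)
next
  case False
  define r where "r = enn2real p"
  have r: "1 \<le> r"
    unfolding r_def using assms(1) False
    by (metis enn2real_mono enn2real_1 infinity_ennreal_def top.not_eq_extremum)
  have "(\<Sum>i<N. \<bar>u * x i + v * y i\<bar> powr r) \<le> (\<Sum>i<N. u * \<bar>x i\<bar> powr r + v * \<bar>y i\<bar> powr r)"
  proof (intro sum_mono)
    fix i
    show "\<bar>u * x i + v * y i\<bar> powr r \<le> u * \<bar>x i\<bar> powr r + v * \<bar>y i\<bar> powr r"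
      using convex_onD[OF convex_on_abs_powr[OF r], of v "x i" "y i"] assms(5-7)
      by (simp add: eq_diff_eq[symmetric])
  qed
  also have "\<dots> = u * (\<Sum>i<N. \<bar>x i\<bar> powr r) + v * (\<Sum>i<N. \<bar>y i\<bar> powr r)"
    by (simp add: sum.distrib sum_distrib_left)
  also have "\<dots> \<le> u * w powr r + v * w powr r"
    using assms False unfolding r_def
    by (intro add_mono mult_left_mono) (auto simp: lp_norm_finite_le_iff)
  also have "\<dots> = w powr r" using assms(7) by (simp flip: distrib_right)
  finally show ?thesis
    using assms False by (simp add: lp_norm_finite_le_iff r_def)
qed

lemma closed_lp_ball:
  assumes "1 \<le> p" "0 \<le> w"
  shows "closed {z. lp_norm p N z \<le> w}"
proof (cases "p = \<infinity>")
  case True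
  have "closed {z :: nat \<Rightarrow> real. \<forall>i<N. \<bar>z i\<bar> \<le> w}"
    by (intro closed_Collect_all closed_Collect_imp open_Collect_const closed_Collect_le
        continuous_intros continuous_on_product_coordinates)
  then show ?thesis using True assms by (simp add: lp_norm_top_le_iff)
next
  case False
  then have "0 < enn2real p"
    using assms(1) by (auto simp: enn2real_positive_iff top.not_eq_extremum intro: less_le_trans[OF ennreal_zero_less_one])
  then have "closed {z. (\<Sum>i<N. \<bar>z i\<bar> powr enn2real p) \<le> w powr enn2real p}"
    by (intro closed_Collect_le continuous_intros continuous_on_powr' continuous_on_product_coordinates) auto
  then show ?thesis using False assms by (simp add: lp_norm_finite_le_iff)
qed

text \<open>The ball leaves the coordinates from \<open>N\<close> on unconstrained. The box pins
  them to 0 and confines the others, which the ball does anyway, so Tychonoff's theorem gives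
  compactness in the product topology.\<close>

lemma compact_lp_ball:
  assumes "1 \<le> p" "0 \<le> w"
  shows "compact ({z. lp_norm p N z \<le> w} \<inter> (\<Pi>\<^sub>E i\<in>UNIV. if i < N then {-w..w} else {0}))"
proof (rule closed_Int_compact[OF closed_lp_ball[OF assms]])
  have "compactin (product_topology (\<lambda>i. euclidean) UNIV)
      (\<Pi>\<^sub>E i\<in>UNIV. if i < N then {-w..w} else {0::real})"
    by (subst compactin_PiE) (auto simp: compactin_euclidean_iff)
  then show "compact (\<Pi>\<^sub>E i\<in>UNIV. if i < N then {-w..w} else {0::real})"
    by (simp add: euclidean_product_topology compactin_euclidean_iff)
qed

section \<open>The dual problem\<close>

lemma sym_representer_eqI:
  assumes "Y \<in> sym_mats" "\<And>X. X \<in> sym_mats \<Longrightarrow> Y \<bullet> X = \<phi> X"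
  shows "sym_representer \<phi> = Y"
  unfolding sym_representer_def
  by (rule the_equality) (use assms in \<open>auto intro!: sym_representer_unique\<close>)

lemma lp_norm_cong: "(\<And>i. i < N \<Longrightarrow> z i = z' i) \<Longrightarrow> lp_norm p N z = lp_norm p N z'"
  by (simp add: lp_norm_def cong: image_cong_simp)

lemma linear_combination_eq_0_imp_0:
  fixes A :: "'m::finite \<Rightarrow> 'a::real_vector"
  assumes "inj A" "independent (range A)" "(\<Sum>i\<in>UNIV. y $ i *\<^sub>R A i) = 0"
  shows "y = 0"
proof -
  have "(\<Sum>a\<in>range A. (y $ inv A a) *\<^sub>R a) = 0"
    using assms(1,3) by (simp add: sum.reindex)
  then have "y $ inv A (A i) = 0" for i
    using independentD[OF assms(2), of "range A" "\<lambda>a. y $ inv A a" "A i"] by simp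
  then show ?thesis
    using assms(1) by (simp add: vec_eq_iff)
qed

locale logdet_dual =
  fixes P :: "('n::{finite,linorder}, 'm::finite, 'h::finite) logdet_problem"
  assumes C_sym: "costC P \<in> sym_mats"
    and mu_pos: "0 < barrier P"
    and lambda_nonneg: "\<And>h. 0 \<le> weight P h"
    and p_ge_1: "\<And>h. 1 \<le> expo P h"
    and Q_linear: "\<And>h i. i < dimQ P h \<Longrightarrow> linear_on_sym (\<lambda>X. opQ P h X i)"
    and A_sym: "\<And>i. matA P i \<in> sym_mats"
    and A_indep: "inj (matA P)" "independent (range (matA P))"
    and primal_interior: "\<exists>X. pos_definite X \<and> opA P X = rhs P"
begin

abbreviation slack :: "('n, 'm, 'h) dual_var \<Rightarrow> real^'n::{finite,linorder}^'n::{finite,linorder}" where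
  "slack U \<equiv> costC P + opB P U"

lemma opA_inner: "opA P X \<bullet> y = (\<Sum>i\<in>UNIV. y $ i *\<^sub>R matA P i) \<bullet> X"
  by (simp add: opA_def inner_vec_def[of "\<chi> i. _ i"] inner_sum_left mult.commute)

lemma adjA_eq: "adjA P y = (\<Sum>i\<in>UNIV. y $ i *\<^sub>R matA P i)"
  unfolding adjA_def
proof (rule sym_representer_eqI)
  show "(\<Sum>i\<in>UNIV. y $ i *\<^sub>R matA P i) \<in> sym_mats"
    by (intro subspace_sum subspace_scale subspace_sym_mats A_sym)
qed (rule opA_inner[symmetric])

text \<open>This form shows linearity and continuity in \<open>z\<close>, and that only the
  coordinates below \<open>dimQ P h\<close> matter.\<close>

lemma adjQ_eq: "adjQ P h z = (\<Sum>i<dimQ P h. z i *\<^sub>R sym_representer (\<lambda>X. opQ P h X i))"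
  unfolding adjQ_def
proof (rule sym_representer_eqI)
  show "(\<Sum>i<dimQ P h. z i *\<^sub>R sym_representer (\<lambda>X. opQ P h X i)) \<in> sym_mats"
    by (intro subspace_sum subspace_scale subspace_sym_mats sym_representer(1) Q_linear) auto
  show "(\<Sum>i<dimQ P h. z i *\<^sub>R sym_representer (\<lambda>X. opQ P h X i)) \<bullet> X = (\<Sum>i<dimQ P h. opQ P h X i * z i)"
    if "X \<in> sym_mats" for X
    unfolding inner_sum_left using that
    by (intro sum.cong) (auto simp: sym_representer(2)[OF Q_linear] mult.commute)
qed

lemma setS_sym: "S \<in> setS P h \<Longrightarrow> S \<in> sym_mats"
  by (auto simp: setS_def adjQ_eq intro!: subspace_sum subspace_scale subspace_sym_mats
      sym_representer(1) Q_linear)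

lemma convex_setS: "convex (setS P h)"
proof (rule convexI)
  fix X Y u v assume XY: "X \<in> setS P h" "Y \<in> setS P h" and uv: "0 \<le> u" "0 \<le> v" "u + v = (1::real)"
  from XY obtain x y where x: "X = adjQ P h x" "lp_norm (conj_exponent (expo P h)) (dimQ P h) x \<le> weight P h"
    and y: "Y = adjQ P h y" "lp_norm (conj_exponent (expo P h)) (dimQ P h) y \<le> weight P h"
    by (auto simp: setS_def)
  have "u *\<^sub>R X + v *\<^sub>R Y = adjQ P h (\<lambda>i. u * x i + v * y i)"
    by (simp add: x(1) y(1) adjQ_eq scaleR_sum_right sum.distrib scaleR_left_distrib)
  moreover have "lp_norm (conj_exponent (expo P h)) (dimQ P h) (\<lambda>i. u * x i + v * y i) \<le> weight P h"
    by (rule lp_norm_convex[OF conj_exponent_ge_1[OF p_ge_1] lambda_nonneg x(2) y(2) uv])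
  ultimately show "u *\<^sub>R X + v *\<^sub>R Y \<in> setS P h"
    unfolding setS_def by blast
qed

lemma compact_setS: "compact (setS P h)"
proof -
  let ?p = "conj_exponent (expo P h)" and ?N = "dimQ P h" and ?w = "weight P h"
  define K where "K = {z. lp_norm ?p ?N z \<le> ?w} \<inter> (\<Pi>\<^sub>E i\<in>UNIV. if i < ?N then {-?w..?w} else {0})"
  have ge: "1 \<le> ?p" by (rule conj_exponent_ge_1[OF p_ge_1])
  have "setS P h = adjQ P h ` K"
  proof
    show "setS P h \<subseteq> adjQ P h ` K"
    proof
      fix S assume "S \<in> setS P h"
      then obtain z where z: "S = adjQ P h z" "lp_norm ?p ?N z \<le> ?w" by (auto simp: setS_def)
      \<comment> \<open>Clearing the coordinates that neither the norm nor the adjoint reads moves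
        \<open>z\<close> into the compact set \<open>K\<close> without changing its image.\<close>
      define z' where "z' = (\<lambda>i. if i < ?N then z i else 0)"
      have "lp_norm ?p ?N z' = lp_norm ?p ?N z"
        by (rule lp_norm_cong) (simp add: z'_def)
      moreover have "\<bar>z i\<bar> \<le> ?w" if "i < ?N" for i
        using lp_norm_coord_le[OF ge lambda_nonneg z(2) that] .
      ultimately have "z' \<in> K"
        using z(2) by (auto simp: K_def z'_def abs_le_iff minus_le_iff)
      moreover have "S = adjQ P h z'"
        by (simp add: z(1) z'_def adjQ_eq)
      ultimately show "S \<in> adjQ P h ` K" by blast
    qed
  qed (auto simp: setS_def K_def)
  moreover have "continuous_on K (adjQ P h)"
    unfolding adjQ_eq
    by (intro continuous_intros continuous_on_subset[OF continuous_on_product_coordinates] subset_UNIV)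
  moreover have "compact K"
    unfolding K_def by (rule compact_lp_ball[OF ge lambda_nonneg])
  ultimately show ?thesis
    by (simp add: compact_continuous_image)
qed

section \<open>The constraint set and the slack operator\<close>

lemma convex_setM: "convex (setM P)"
  using convex_setS by (auto simp: convex_def setM_def)

lemma closed_setM: "closed (setM P)"
proof -
  have "closed {U :: ('n, 'm, 'h) dual_var. snd U $ h \<in> setS P h}" for h
    using closed_vimage[OF compact_imp_closed[OF compact_setS], of "\<lambda>U :: ('n, 'm, 'h) dual_var. snd U $ h" h]
    by (simp add: vimage_def continuous_intros)
  then show ?thesis
    unfolding setM_def by (rule closed_Collect_all)
qed

lemma opB_eq: "opB P U = (\<Sum>h\<in>UNIV. snd U $ h) - (\<Sum>i\<in>UNIV. fst U $ i *\<^sub>R matA P i)"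
  by (simp add: opB_def adjA_eq)

lemma linear_opB: "linear (opB P)"
  by (rule linearI)
    (simp_all add: opB_eq sum.distrib scaleR_left_distrib scaleR_sum_right scaleR_diff_right)

lemma opB_sym: "U \<in> setM P \<Longrightarrow> opB P U \<in> sym_mats"
  unfolding opB_eq
  by (intro subspace_diff subspace_sum subspace_scale subspace_sym_mats A_sym)
    (auto simp: setM_def intro: setS_sym)

lemma opB_diff: "opB P V - opB P U = opB P (V - U)"
  by (simp add: linear_diff[OF linear_opB])

lemma opB_step: "slack (U + t *\<^sub>R D) = slack U + t *\<^sub>R opB P D"
  by (simp add: linear_add[OF linear_opB] linear_scale[OF linear_opB])

lemma opB_bounded: obtains K where "0 < K" "\<And>U. norm (opB P U) \<le> K * norm U"
  using bounded_linear.pos_bounded[OF linear_conv_bounded_linear[THEN iffD1, OF linear_opB]]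
  by (auto simp: mult.commute)

text \<open>The adjoint relation behind the formula for the gradient: apart from the linear term, a
  direction \<open>W\<close> enters only through the change \<open>opB P W\<close> of the slack
  matrix. This connects matrix inequalities for the slack with the dual variables.\<close>

lemma dual_grad_inner: "dual_grad P U \<bullet> W = rhs P \<bullet> fst W + primal_of P U \<bullet> opB P W"
proof -
  have "dual_grad P U \<bullet> W = (rhs P - opA P (primal_of P U)) \<bullet> fst W + (\<Sum>h\<in>UNIV. primal_of P U \<bullet> snd W $ h)"
    by (simp add: dual_grad_def inner_prod_def inner_vec_def[of "\<chi> h. primal_of P U"])
  then show ?thesis
    by (simp add: opA_inner opB_eq inner_diff_left inner_diff_right inner_sum_left inner_sum_right
        inner_commute[of "primal_of P U"])
qed

section \<open>Concavity, level sets and curvature of the dual objective\<close>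

lemma dual_obj_tangent:
  assumes "U \<in> dual_feasible P" "V \<in> dual_feasible P"
  shows "dual_obj P V \<le> dual_obj P U + dual_grad P U \<bullet> (V - U)"
proof -
  have "barrier P * ln (det (slack V))
      \<le> barrier P * (ln (det (slack U)) + matrix_inv (slack U) \<bullet> (slack V - slack U))"
    using assms mu_pos by (intro mult_left_mono ln_det_tangent) (auto simp: dual_feasible_def)
  also have "slack V - slack U = opB P (V - U)"
    by (simp add: opB_diff)
  finally show ?thesis
    unfolding dual_obj_def dual_grad_inner
    by (simp add: primal_of_def inner_diff_right algebra_simps)
qed

text \<open>Substituting \<open>rhs P = opA P X\<close> turns the linear term into \<open>X\<close>
  paired with \<open>adjA P y\<close>, which is cost plus sum of the \<open>S\<close> blocks minus
  slack. The blocks are bounded, so the objective is at most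
  \<open>barrier P * ln (det Z) - X \<bullet> Z + k\<close> at the slack \<open>Z\<close>, and
  \<open>log_det_level_set\<close> applies. The bound on \<open>Z\<close> bounds
  \<open>adjA P y\<close>, hence \<open>y\<close> by independence of the matrices
  \<open>matA P i\<close>.\<close>

lemma dual_level_set:
  obtains \<eta> r where "0 < \<eta>"
    and "\<And>U. U \<in> dual_feasible P \<Longrightarrow> c \<le> dual_obj P U \<Longrightarrow> norm U \<le> r"
    and "\<And>U v. U \<in> dual_feasible P \<Longrightarrow> c \<le> dual_obj P U \<Longrightarrow> \<eta> * (v \<bullet> v) \<le> v \<bullet> (slack U *v v)"
proof -
  obtain X where X: "pos_definite X" "opA P X = rhs P"
    using primal_interior by blast
  have "\<forall>h. \<exists>b. \<forall>S\<in>setS P h. norm S \<le> b"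
    using compact_imp_bounded[OF compact_setS] by (simp add: bounded_iff)
  then obtain b where b: "\<And>h S. S \<in> setS P h \<Longrightarrow> norm S \<le> b h"
    by metis
  have sum_S: "norm (\<Sum>h\<in>UNIV. snd U $ h) \<le> (\<Sum>h\<in>UNIV. b h)" and norm_snd: "norm (snd U) \<le> (\<Sum>h\<in>UNIV. b h)"
    if "U \<in> dual_feasible P" for U
  proof -
    have *: "(\<Sum>h\<in>UNIV. norm (snd U $ h)) \<le> (\<Sum>h\<in>UNIV. b h)"
      using that by (intro sum_mono b) (auto simp: dual_feasible_def setM_def)
    then show "norm (\<Sum>h\<in>UNIV. snd U $ h) \<le> (\<Sum>h\<in>UNIV. b h)"
      by (rule order_trans[OF norm_sum])
    from * show "norm (snd U) \<le> (\<Sum>h\<in>UNIV. b h)"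
      by (rule order_trans[rotated]) (simp add: norm_vec_def L2_set_le_sum)
  qed
  have linear_adj: "linear (\<lambda>y. \<Sum>i\<in>UNIV. y $ i *\<^sub>R matA P i)"
    by (rule linearI) (simp_all add: sum.distrib scaleR_left_distrib scaleR_sum_right)
  then have "inj (\<lambda>y. \<Sum>i\<in>UNIV. y $ i *\<^sub>R matA P i)"
    using linear_combination_eq_0_imp_0[OF A_indep]
    by (simp add: linear_injective_0)
  then obtain B where B: "0 < B" "\<And>y. B * norm y \<le> norm (\<Sum>i\<in>UNIV. y $ i *\<^sub>R matA P i)"
    using linear_inj_bounded_below_pos[OF linear_adj] by blast
  define k where "k = X \<bullet> costC P + norm X * (\<Sum>h\<in>UNIV. b h) + real CARD('n) * barrier P
    - real CARD('n) * barrier P * ln (barrier P)"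
  obtain \<eta> T where \<eta>: "0 < \<eta>"
    and T: "\<And>Z. pos_definite Z \<Longrightarrow> c - k \<le> barrier P * ln (det Z) - X \<bullet> Z \<Longrightarrow> norm Z \<le> T"
    and \<eta>': "\<And>Z v. pos_definite Z \<Longrightarrow> c - k \<le> barrier P * ln (det Z) - X \<bullet> Z \<Longrightarrow> \<eta> * (v \<bullet> v) \<le> v \<bullet> (Z *v v)"
    using log_det_level_set[OF X(1) mu_pos] by blast
  have adj: "(\<Sum>i\<in>UNIV. fst U $ i *\<^sub>R matA P i) = costC P + (\<Sum>h\<in>UNIV. snd U $ h) - slack U" for U
    by (simp add: opB_eq)
  have level: "c - k \<le> barrier P * ln (det (slack U)) - X \<bullet> slack U"
    if U: "U \<in> dual_feasible P" and c: "c \<le> dual_obj P U" for U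
  proof -
    have "rhs P \<bullet> fst U = X \<bullet> costC P + X \<bullet> (\<Sum>h\<in>UNIV. snd U $ h) - X \<bullet> slack U"
      unfolding X(2)[symmetric] opA_inner adj by (simp add: inner_commute inner_diff_right inner_add_right)
    moreover have "X \<bullet> (\<Sum>h\<in>UNIV. snd U $ h) \<le> norm X * (\<Sum>h\<in>UNIV. b h)"
      by (rule order_trans[OF norm_cauchy_schwarz]) (intro mult_left_mono sum_S U norm_ge_zero)
    ultimately show ?thesis
      using c by (simp add: dual_obj_def k_def)
  qed
  have "norm U \<le> (norm (costC P) + (\<Sum>h\<in>UNIV. b h) + T) / B + (\<Sum>h\<in>UNIV. b h)"
    if U: "U \<in> dual_feasible P" and c: "c \<le> dual_obj P U" for U
  proof -
    have "B * norm (fst U) \<le> norm (costC P + (\<Sum>h\<in>UNIV. snd U $ h) - slack U)"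
      using B(2)[of "fst U"] by (simp only: adj)
    also have "\<dots> \<le> norm (costC P + (\<Sum>h\<in>UNIV. snd U $ h)) + norm (slack U)"
      by (rule norm_triangle_ineq4)
    also have "\<dots> \<le> norm (costC P) + norm (\<Sum>h\<in>UNIV. snd U $ h) + norm (slack U)"
      by (intro add_right_mono norm_triangle_ineq)
    also have "\<dots> \<le> norm (costC P) + (\<Sum>h\<in>UNIV. b h) + T"
      using U by (intro add_mono order_refl sum_S T level c) (auto simp: dual_feasible_def)
    finally have "norm (fst U) \<le> (norm (costC P) + (\<Sum>h\<in>UNIV. b h) + T) / B"
      using B(1) by (simp add: field_simps)
    moreover have "norm U \<le> norm (fst U) + norm (snd U)"
      using norm_Pair_le[of "fst U" "snd U"] by simp
    ultimately show ?thesis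
      using norm_snd[OF U] by linarith
  qed
  moreover have "\<eta> * (v \<bullet> v) \<le> v \<bullet> (slack U *v v)"
    if U: "U \<in> dual_feasible P" and c: "c \<le> dual_obj P U" for U v
    using U by (intro \<eta>' level c) (auto simp: dual_feasible_def)
  ultimately show thesis
    using that \<eta> by blast
qed

lemma dual_grad_bounded:
  assumes "0 < \<eta>"
  obtains G where "0 < G"
    and "\<And>U. U \<in> dual_feasible P \<Longrightarrow> (\<And>v. \<eta> * (v \<bullet> v) \<le> v \<bullet> (slack U *v v)) \<Longrightarrow> norm (dual_grad P U) \<le> G"
proof -
  \<comment> \<open>The linear part of the gradient as a function of the primal matrix. The 1 added
    to the bound below makes it strictly positive.\<close>
  define F where "F = (\<lambda>X. (- opA P X, (\<chi> h. X)) :: ('n, 'm, 'h) dual_var)"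
  have "linear F"
    by (rule linearI) (auto simp: F_def opA_def vec_eq_iff inner_add_right)
  then obtain K where K: "0 < K" "\<And>X. norm (F X) \<le> norm X * K"
    using bounded_linear.pos_bounded linear_conv_bounded_linear by blast
  have "norm (dual_grad P U) \<le> norm (rhs P) + barrier P * (sqrt (real CARD('n)) / \<eta>) * K + 1"
    if "U \<in> dual_feasible P" and bnd: "\<And>v. \<eta> * (v \<bullet> v) \<le> v \<bullet> (slack U *v v)" for U
  proof -
    have "dual_grad P U = (rhs P, 0) + F (primal_of P U)"
      by (simp add: dual_grad_def F_def)
    then have "norm (dual_grad P U) \<le> norm (rhs P) + norm (F (primal_of P U))"
      using norm_triangle_ineq[of "(rhs P, 0)" "F (primal_of P U)"] by (simp add: norm_Pair)
    also have "norm (F (primal_of P U)) \<le> norm (primal_of P U) * K"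
      by (rule K(2))
    also have "norm (primal_of P U) \<le> barrier P * (sqrt (real CARD('n)) / \<eta>)"
    proof -
      have "norm (matrix_inv (slack U)) \<le> sqrt (real CARD('n)) / \<eta>"
        using that(1) by (intro norm_matrix_inv_le[OF _ assms bnd] pos_definite_invertible)
          (simp add: dual_feasible_def)
      then have "barrier P * norm (matrix_inv (slack U)) \<le> barrier P * (sqrt (real CARD('n)) / \<eta>)"
        using mu_pos by (intro mult_left_mono) auto
      then show ?thesis
        using mu_pos by (simp add: primal_of_def)
    qed
    finally show ?thesis
      using K(1) by (simp add: mult_right_mono)
  qed
  moreover have "0 < norm (rhs P) + barrier P * (sqrt (real CARD('n)) / \<eta>) * K + 1"
    using K(1) mu_pos assms by (intro add_nonneg_pos add_nonneg_nonneg mult_nonneg_nonneg) auto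
  ultimately show thesis
    using that by blast
qed

text \<open>
  The tangent inequality at the new point bounds the objective from below there; the gradients
  differ by at most a multiple of the step, by the resolvent identity.
\<close>

lemma dual_obj_quadratic_lower:
  assumes "0 < \<eta>"
  obtains \<Lambda> where "0 < \<Lambda>"
    and "\<And>U V. U \<in> dual_feasible P \<Longrightarrow> V \<in> dual_feasible P \<Longrightarrow>
          (\<And>v. \<eta> * (v \<bullet> v) \<le> v \<bullet> (slack U *v v)) \<Longrightarrow> (\<And>v. \<eta> * (v \<bullet> v) \<le> v \<bullet> (slack V *v v)) \<Longrightarrow>
          dual_obj P U + dual_grad P U \<bullet> (V - U) - \<Lambda> * (norm (V - U))\<^sup>2 \<le> dual_obj P V"
proof -
  obtain K where K: "0 < K" "\<And>(A :: real^'n::{finite,linorder}^'n::{finite,linorder}) (B :: real^'n::{finite,linorder}^'n::{finite,linorder}). norm (A ** B) \<le> norm A * norm B * K"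
    using bounded_bilinear.pos_bounded[OF bounded_bilinear_matrix_matrix_mult] by blast
  obtain \<beta> where \<beta>: "0 < \<beta>" "\<And>U. norm (opB P U) \<le> \<beta> * norm U"
    using opB_bounded by blast
  define q where "q = sqrt (real CARD('n)) / \<eta>"
  \<comment> \<open>One factor \<open>q\<close> for each of the two inverses in the resolvent
    identity, one \<open>K\<close> for each of its two products, and one \<open>\<beta>\<close> for
    each of the two occurrences of \<open>opB P (V - U)\<close>.\<close>
  define \<Lambda> where "\<Lambda> = barrier P * (q * \<beta> * K * q * K) * \<beta>"
  have "0 < q" using assms by (simp add: q_def)
  then have "0 < \<Lambda>"
    using mu_pos K(1) \<beta>(1) by (simp add: \<Lambda>_def)
  moreover have "dual_obj P U + dual_grad P U \<bullet> (V - U) - \<Lambda> * (norm (V - U))\<^sup>2 \<le> dual_obj P V"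
    if UV: "U \<in> dual_feasible P" "V \<in> dual_feasible P"
      and bU: "\<And>v. \<eta> * (v \<bullet> v) \<le> v \<bullet> (slack U *v v)" and bV: "\<And>v. \<eta> * (v \<bullet> v) \<le> v \<bullet> (slack V *v v)"
    for U V
  proof -
    have inv: "invertible (slack U)" "invertible (slack V)"
      using UV by (auto simp: dual_feasible_def pos_definite_invertible)
    let ?W = "opB P (V - U)" and ?I = "matrix_inv (slack V)" and ?J = "matrix_inv (slack U)"
    have nI: "norm ?I \<le> q" and nJ: "norm ?J \<le> q"
      unfolding q_def using norm_matrix_inv_le[OF _ assms] inv bU bV by blast+
    have "?I ** (slack V - slack U) ** ?J = ?I ** slack V ** ?J - ?I ** (slack U ** ?J)"
      by (simp only: bounded_bilinear.diff_left[OF bounded_bilinear_matrix_matrix_mult]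
          bounded_bilinear.diff_right[OF bounded_bilinear_matrix_matrix_mult] matrix_mul_assoc)
    then have "?J - ?I = ?I ** (slack V - slack U) ** ?J"
      using matrix_inv_left[OF inv(2)] matrix_inv_right[OF inv(1)] by simp
    also have "slack V - slack U = ?W"
      by (simp add: opB_diff)
    finally have "norm (?J - ?I) = norm (?I ** ?W ** ?J)" by simp
    also have "\<dots> \<le> norm (?I ** ?W) * norm ?J * K" by (rule K(2))
    also have "\<dots> \<le> (norm ?I * norm ?W * K) * norm ?J * K"
      using K(1) by (intro mult_right_mono K(2)) auto
    also have "\<dots> \<le> (q * (\<beta> * norm (V - U)) * K) * q * K"
      using K(1) \<beta>(1) \<open>0 < q\<close> by (intro mult_mono nI nJ \<beta>(2)) auto
    finally have diff: "norm (?J - ?I) \<le> (q * \<beta> * K * q * K) * norm (V - U)"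
      by (simp add: ac_simps)
    have "(dual_grad P U - dual_grad P V) \<bullet> (V - U) = barrier P * ((?J - ?I) \<bullet> ?W)"
      unfolding inner_diff_left dual_grad_inner
      by (simp add: primal_of_def right_diff_distrib)
    also have "\<dots> \<le> barrier P * (norm (?J - ?I) * norm ?W)"
      using mu_pos by (intro mult_left_mono norm_cauchy_schwarz) auto
    also have "\<dots> \<le> barrier P * ((q * \<beta> * K * q * K) * norm (V - U) * (\<beta> * norm (V - U)))"
      using mu_pos K(1) \<beta> \<open>0 < q\<close> by (intro mult_left_mono mult_mono diff) auto
    also have "\<dots> = \<Lambda> * (norm (V - U))\<^sup>2"
      by (simp add: \<Lambda>_def power2_eq_square)
    finally have "dual_grad P U \<bullet> (V - U) - \<Lambda> * (norm (V - U))\<^sup>2 \<le> dual_grad P V \<bullet> (V - U)"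
      by (simp add: inner_diff_left)
    moreover have "dual_obj P U \<le> dual_obj P V - dual_grad P V \<bullet> (V - U)"
      using dual_obj_tangent[OF UV(2,1)] by (simp add: inner_diff_right)
    ultimately show ?thesis by linarith
  qed
  ultimately show thesis using that by blast
qed

end

section \<open>The algorithm\<close>

text \<open>Substituting \<open>transpose L *v w\<close> turns the form of \<open>Z\<close> into a
  squared norm, so \<open>\<theta>\<close> is the least generalized eigenvalue of the pair
  \<open>B\<close>, \<open>Z\<close>. The inequality keeps damped steps feasible; its attainment
  prevents \<open>\<theta>\<close> from being very negative.\<close>

lemma min_eigenvalue_cholesky_congruence:
  fixes Z B L :: "real^'n::{finite,linorder}^'n::{finite,linorder}"
  assumes L: "cholesky_factor Z L" and B: "B \<in> sym_mats"
  defines "\<theta> \<equiv> min_eigenvalue (matrix_inv L ** B ** matrix_inv (transpose L))"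
  shows "\<theta> * (w \<bullet> (Z *v w)) \<le> w \<bullet> (B *v w)"
    and "\<exists>w. w \<noteq> 0 \<and> w \<bullet> (B *v w) = \<theta> * (w \<bullet> (Z *v w))"
proof -
  define G where "G = matrix_inv L"
  define M where "M = G ** B ** transpose G"
  have Z: "Z = L ** transpose L" using L by (simp add: cholesky_factor_def)
  note invL = cholesky_factor_invertible[OF L]
  have LG: "L ** G = mat 1" and Gt: "matrix_inv (transpose L) = transpose G"
    by (simp_all add: G_def matrix_inv_right[OF invL] matrix_inv_transpose[OF invL])
  then have GtLt: "transpose G ** transpose L = mat 1"
    by (simp flip: matrix_transpose_mul)
  have LtGt: "transpose L ** transpose G = mat 1"
    using matrix_inv_left[OF invL] by (simp add: G_def flip: matrix_transpose_mul)
  have \<theta>: "\<theta> = min_eigenvalue M"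
    by (simp add: \<theta>_def M_def Gt flip: G_def)
  have M: "M \<in> sym_mats"
    using B by (simp add: M_def sym_mats_def matrix_transpose_mul matrix_mul_assoc)
  have adj: "(transpose L *v w) \<bullet> x = w \<bullet> (L *v x)" for w x
    by (simp add: dot_lmul_matrix)
  have ZL: "(transpose L *v w) \<bullet> (transpose L *v w) = w \<bullet> (Z *v w)" for w
    unfolding adj by (simp only: Z matrix_vector_mul_assoc)
  have BM: "(transpose L *v w) \<bullet> (M *v (transpose L *v w)) = w \<bullet> (B *v w)" for w
  proof -
    have "L ** (M ** transpose L) = (L ** G) ** B ** (transpose G ** transpose L)"
      by (simp add: M_def matrix_mul_assoc)
    also have "\<dots> = B"
      by (simp add: LG GtLt)
    finally show ?thesis
      unfolding adj by (simp only: matrix_vector_mul_assoc)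
  qed
  show "\<theta> * (w \<bullet> (Z *v w)) \<le> w \<bullet> (B *v w)"
    using min_eigenvalue_le[OF M, of "transpose L *v w"] by (simp only: \<theta> ZL BM)
  obtain v where v: "v \<noteq> 0" "M *v v = \<theta> *\<^sub>R v"
    using min_eigenvalue_eigenvector[OF M] unfolding \<theta> by blast
  define w where "w = transpose G *v v"
  have vw: "transpose L *v w = v"
    by (simp only: w_def matrix_vector_mul_assoc LtGt matrix_vector_mul_lid)
  have "w \<bullet> (B *v w) = \<theta> * (w \<bullet> (Z *v w))"
    using ZL[of w] BM[of w] by (simp add: vw v(2) del: transpose_matrix_vector)
  moreover have "w \<noteq> 0"
    using vw v(1) by (metis matrix_vector_mult_0_right)
  ultimately show "\<exists>w. w \<noteq> 0 \<and> w \<bullet> (B *v w) = \<theta> * (w \<bullet> (Z *v w))"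
    by blast
qed

text \<open>
  The bound \<open>d\<^sup>2 \<le> (m k - m (k - M)) / c\<close> for the step into the worst point of the window tends to 0
  because the window minima \<open>m\<close> increase to a limit.
\<close>

lemma nonmonotone_line_search_limit:
  fixes a d :: "nat \<Rightarrow> real"
  assumes "0 < M" "0 < c" "0 \<le> K"
    and d: "\<And>k. 0 \<le> d k"
    and inc: "\<And>k. Min (a ` {k + 1 - M..k}) + c * (d k)\<^sup>2 \<le> a (Suc k)"
    and le: "\<And>k. a k \<le> s"
    and gap: "\<And>k. s - a k \<le> K * d k"
    and lip: "\<And>k. a k - G * d k \<le> a (Suc k)"
    and "0 \<le> G"
  shows "a \<longlonglongrightarrow> s"
proof -
  define m where "m k = Min (a ` {k + 1 - M..k})" for k
  have m_le: "m k \<le> a l" if "k + 1 - M \<le> l" "l \<le> k" for k l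
    unfolding m_def using that by (intro Min_le) auto
  have m_self: "m k \<le> a k" for k
    using \<open>0 < M\<close> by (intro m_le) linarith+
  have m_attained: "\<exists>l. k + 1 - M \<le> l \<and> l \<le> k \<and> m k = a l" for k
  proof -
    have "m k \<in> a ` {k + 1 - M..k}"
      unfolding m_def using \<open>0 < M\<close> by (intro Min_in) auto
    then show ?thesis by auto
  qed
  have inc': "m k + c * (d k)\<^sup>2 \<le> a (Suc k)" for k
    using inc by (simp add: m_def)
  \<comment> \<open>The only index that enters the next window is \<open>Suc k\<close>, and the
    value there is at least \<open>m k\<close>.\<close>
  have "m k \<le> m (Suc k)" for k
  proof -
    obtain l where l: "Suc k + 1 - M \<le> l" "l \<le> Suc k" "m (Suc k) = a l"
      using m_attained by blast
    show ?thesis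
    proof (cases "l = Suc k")
      case True
      then show ?thesis
        using inc'[of k] l(3) \<open>0 < c\<close> by (auto intro: order_trans[rotated])
    next
      case False
      then show ?thesis using l m_le[of k l] by simp
    qed
  qed
  then have "incseq m" by (rule incseq_SucI)
  moreover have m_s: "m k \<le> s" for k
    using m_self le by (rule order_trans)
  ultimately obtain l where "m \<longlonglongrightarrow> l"
    using incseq_convergent by blast
  then have "(\<lambda>k. m (k + M) - m k) \<longlonglongrightarrow> l - l"
    by (intro tendsto_diff LIMSEQ_ignore_initial_segment)
  then have "(\<lambda>k. (K + G) * sqrt ((m (k + M) - m k) / c)) \<longlonglongrightarrow> (K + G) * sqrt ((l - l) / c)"
    by (intro tendsto_mult tendsto_const tendsto_real_sqrt tendsto_divide) (use \<open>0 < c\<close> in auto)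
  then have lim: "(\<lambda>k. (K + G) * sqrt ((m (k + M) - m k) / c)) \<longlonglongrightarrow> 0" by simp
  have bound: "s - a (k + M) \<le> (K + G) * sqrt ((m (k + M) - m k) / c)" for k
  proof -
    \<comment> \<open>The window at \<open>k + M\<close> starts at \<open>k + 1\<close>, so its
      worst index is a successor \<open>Suc i\<close> with \<open>k \<le> i\<close>, and the
      increase at step \<open>i\<close> starts from at least \<open>m k\<close>.\<close>
    obtain l where l: "k + M + 1 - M \<le> l" "l \<le> k + M" "m (k + M) = a l"
      using m_attained by blast
    then obtain i where i: "l = Suc i" "k \<le> i" by (cases l) auto
    have "m k + c * (d i)\<^sup>2 \<le> m (k + M)"
      using inc'[of i] incseqD[OF \<open>incseq m\<close> i(2)] l(3) i(1) by simp
    then have "(d i)\<^sup>2 \<le> (m (k + M) - m k) / c"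
      using \<open>0 < c\<close> by (simp add: field_simps)
    then have di: "d i \<le> sqrt ((m (k + M) - m k) / c)"
      by (rule real_le_rsqrt)
    have "s - a (k + M) \<le> s - m (k + M)"
      using m_self[of "k + M"] by simp
    \<comment> \<open>The gap before the step costs \<open>K * d i\<close>, the possible drop during
      the step \<open>G * d i\<close>.\<close>
    also have "\<dots> \<le> (K + G) * d i"
      using gap[of i] lip[of i] l(3) i(1) by (simp add: distrib_right)
    also have "\<dots> \<le> (K + G) * sqrt ((m (k + M) - m k) / c)"
      using di \<open>0 \<le> K\<close> \<open>0 \<le> G\<close> by (intro mult_left_mono) auto
    finally show ?thesis .
  qed
  have "(\<lambda>k. s - a (k + M)) \<longlonglongrightarrow> 0"
    by (rule tendsto_sandwich[OF _ _ tendsto_const lim]) (use le bound in auto)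
  then have "(\<lambda>k. s - (s - a (k + M))) \<longlonglongrightarrow> s - 0"
    by (intro tendsto_diff tendsto_const)
  then show ?thesis
    using LIMSEQ_offset[of a M s] by simp
qed

section \<open>The projected gradient step\<close>

context logdet_dual
begin

text \<open>Everything follows from the variational inequality \<open>dot\<close> of the projection.
  Testing it with \<open>U\<close> itself shows that \<open>D\<close> is an ascent direction and, by
  Cauchy-Schwarz, bounds its length; a general \<open>V\<close> gives the last part after dropping
  the square of \<open>D\<close>.\<close>

lemma proj_step_props:
  assumes U: "U \<in> setM P" and "0 < t"
  defines "D \<equiv> proj_step P t U"
  shows "U + D \<in> setM P"
    and "(norm D)\<^sup>2 \<le> t * (dual_grad P U \<bullet> D)"
    and "norm D \<le> t * norm (dual_grad P U)"
    and "V \<in> setM P \<Longrightarrow> t * (dual_grad P U \<bullet> (V - U)) \<le> t * (dual_grad P U \<bullet> D) + D \<bullet> (V - U)"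
proof -
  let ?g = "dual_grad P U"
  have ne: "setM P \<noteq> {}" using U by blast
  have UD: "U + D = closest_point (setM P) (U + t *\<^sub>R ?g)"
    by (simp add: D_def proj_step_def)
  show "U + D \<in> setM P"
    unfolding UD by (rule closest_point_in_set[OF closed_setM ne])
  have dot: "(t *\<^sub>R ?g - D) \<bullet> (V - U - D) \<le> 0" if "V \<in> setM P" for V
    using closest_point_dot[OF convex_setM closed_setM that, of "U + t *\<^sub>R ?g"]
    unfolding UD[symmetric] by (simp add: algebra_simps)
  from dot[OF U] show sq: "(norm D)\<^sup>2 \<le> t * (?g \<bullet> D)"
    by (simp add: power2_norm_eq_inner inner_diff_left)
  show "norm D \<le> t * norm ?g"
  proof (cases "D = 0")
    case False
    note sq
    also have "t * (?g \<bullet> D) \<le> t * (norm ?g * norm D)"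
      using \<open>0 < t\<close> by (intro mult_left_mono norm_cauchy_schwarz) auto
    finally have "norm D * norm D \<le> (t * norm ?g) * norm D"
      by (simp only: power2_eq_square mult.assoc)
    then show ?thesis using False by simp
  qed (use \<open>0 < t\<close> in simp)
  show "t * (?g \<bullet> (V - U)) \<le> t * (?g \<bullet> D) + D \<bullet> (V - U)" if "V \<in> setM P"
    using add_mono[OF dot[OF that] inner_ge_zero[of D]]
    by (simp add: inner_diff_left inner_diff_right right_diff_distrib)
qed

text \<open>Concavity bounds the gap by the gradient paired with \<open>V - U\<close>, and the
  projection inequality replaces this by terms proportional to the projected step. A zero step thus
  certifies optimality, a short one near-optimality.\<close>

lemma dual_gap_le:
  assumes U: "U \<in> dual_feasible P" and V: "V \<in> dual_feasible P" and "0 < t"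
  shows "dual_obj P V - dual_obj P U
    \<le> (norm (dual_grad P U) + norm (V - U) / t) * norm (proj_step P t U)"
proof -
  let ?g = "dual_grad P U" and ?D = "proj_step P t U"
  have "t * (dual_obj P V - dual_obj P U) \<le> t * (?g \<bullet> (V - U))"
    using dual_obj_tangent[OF U V] \<open>0 < t\<close> by (intro mult_left_mono) auto
  also have "\<dots> \<le> t * (?g \<bullet> ?D) + ?D \<bullet> (V - U)"
    using U V \<open>0 < t\<close> by (intro proj_step_props(4)) (auto simp: dual_feasible_def)
  also have "\<dots> \<le> t * (norm ?g * norm ?D) + norm ?D * norm (V - U)"
    using \<open>0 < t\<close> by (intro add_mono mult_left_mono norm_cauchy_schwarz) auto
  finally show ?thesis
    using \<open>0 < t\<close> by (simp add: field_simps)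
qed

lemma dual_opt_if_stationary:
  assumes U: "U \<in> dual_feasible P" and "proj_step P 1 U = 0"
  shows "dual_obj P U = dual_opt P"
proof -
  have "dual_obj P V \<le> dual_obj P U" if "V \<in> dual_feasible P" for V
    using dual_gap_le[OF U that, of 1] assms(2) by simp
  then show ?thesis
    unfolding dual_opt_def using U by (intro cSup_eq_maximum[symmetric]) auto
qed

text \<open>\<open>\<nu>\<close> is chosen so that \<open>- \<tau> \<le> t * \<theta>\<close> for
  all \<open>t\<close> up to \<open>\<nu>\<close>; by the generalized eigenvalue bound, the slack
  then keeps the fraction \<open>1 - \<tau>\<close> of its quadratic form. As
  \<open>\<nu> \<le> 1\<close>, the new point is a convex combination of \<open>U\<close> and
  \<open>U + D\<close>.\<close>

lemma step_bound_feasible: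
  assumes U: "U \<in> dual_feasible P" and D: "U + D \<in> setM P"
    and L: "cholesky_factor (slack U) L" and \<tau>: "0 < \<tau>" "\<tau> < 1"
    and \<theta>: "\<theta> = min_eigenvalue (matrix_inv L ** opB P D ** matrix_inv (transpose L))"
    and \<nu>: "\<nu> = (if \<theta> \<ge> 0 then 1 else min 1 (- \<tau> / \<theta>))"
  shows "0 < \<nu>" and "\<nu> \<le> 1"
    and "0 \<le> t \<Longrightarrow> t \<le> \<nu> \<Longrightarrow> U + t *\<^sub>R D \<in> dual_feasible P"
    and "0 \<le> t \<Longrightarrow> t \<le> \<nu> \<Longrightarrow> (1 - \<tau>) * (v \<bullet> (slack U *v v)) \<le> v \<bullet> (slack (U + t *\<^sub>R D) *v v)"
    and "\<exists>w. w \<noteq> 0 \<and> w \<bullet> (opB P D *v w) = \<theta> * (w \<bullet> (slack U *v w))"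
proof -
  have UM: "U \<in> setM P" and pd: "pos_definite (slack U)"
    using U by (auto simp: dual_feasible_def)
  have symD: "opB P D \<in> sym_mats"
    using subspace_diff[OF subspace_sym_mats opB_sym[OF D] opB_sym[OF UM]] by (simp add: opB_diff)
  note eig = min_eigenvalue_cholesky_congruence[OF L symD, folded \<theta>]
  show "\<exists>w. w \<noteq> 0 \<and> w \<bullet> (opB P D *v w) = \<theta> * (w \<bullet> (slack U *v w))"
    by (rule eig(2))
  show "0 < \<nu>" and "\<nu> \<le> 1"
    using \<tau> by (auto simp: \<nu> divide_pos_neg)
  have lower: "(1 - \<tau>) * (v \<bullet> (slack U *v v)) \<le> v \<bullet> (slack (U + t *\<^sub>R D) *v v)"
    if t: "0 \<le> t" "t \<le> \<nu>" for t v
  proof -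
    have "- \<tau> \<le> t * \<theta>"
    proof (cases "0 \<le> \<theta>")
      case True
      then show ?thesis using t(1) \<tau>(1) by (simp add: order_trans[of _ 0])
    next
      case False
      then have "t \<le> - \<tau> / \<theta>" using t(2) \<nu> by simp
      then show ?thesis using False by (simp add: field_simps)
    qed
    then have "(1 - \<tau>) * (v \<bullet> (slack U *v v)) \<le> (1 + t * \<theta>) * (v \<bullet> (slack U *v v))"
      by (intro mult_right_mono pos_definite_nonneg[OF pd]) auto
    also have "\<dots> \<le> v \<bullet> (slack U *v v) + t * (v \<bullet> (opB P D *v v))"
      using mult_left_mono[OF eig(1) t(1), of v] by (simp add: algebra_simps)
    also have "\<dots> = v \<bullet> (slack (U + t *\<^sub>R D) *v v)"
      unfolding opB_step
      by (simp add: matrix_vector_mult_add_rdistrib inner_add_right flip: scaleR_matrix_vector_assoc)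
    finally show ?thesis .
  qed
  then show "(1 - \<tau>) * (v \<bullet> (slack U *v v)) \<le> v \<bullet> (slack (U + t *\<^sub>R D) *v v)"
    if "0 \<le> t" "t \<le> \<nu>" using that .
  show "U + t *\<^sub>R D \<in> dual_feasible P" if t: "0 \<le> t" "t \<le> \<nu>"
  proof -
    have "(1 - t) *\<^sub>R U + t *\<^sub>R (U + D) \<in> setM P"
      using t \<open>\<nu> \<le> 1\<close> by (intro convexD[OF convex_setM UM D]) auto
    also have "(1 - t) *\<^sub>R U + t *\<^sub>R (U + D) = U + t *\<^sub>R D"
      by (simp add: algebra_simps)
    finally have M: "U + t *\<^sub>R D \<in> setM P" .
    moreover have "0 < v \<bullet> (slack (U + t *\<^sub>R D) *v v)" if "v \<noteq> 0" for v
    proof -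
      have "0 < (1 - \<tau>) * (v \<bullet> (slack U *v v))"
        using pd that \<tau> by (simp add: pos_definite_def)
      then show ?thesis using lower[OF t, of v] by linarith
    qed
    ultimately show ?thesis
      using subspace_add[OF subspace_sym_mats C_sym opB_sym[OF M]]
      by (simp add: dual_feasible_def pos_definite_def)
  qed
qed

end

section \<open>Step lengths and uniform constants on a level set\<close>

locale dual_spg = logdet_dual P
  for P :: "('n::{finite,linorder}, 'm::finite, 'h::finite) logdet_problem" +
  fixes R :: spg_params
  assumes eps_zero: "eps R = 0"
    and tau: "0 < tau R" "tau R < 1"
    and gamma: "0 < gamma R" "gamma R < 1"
    and beta: "0 < beta R" "beta R < 1"
    and alpha_bounds: "0 < alpha_min R" "alpha_min R < alpha_max R"
    and memory_pos: "0 < memory R"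
begin

text \<open>A relation rather than a function, since \<open>spg_step\<close> admits any Cholesky
  factor.\<close>

definition step_bound :: "('n, 'm, 'h) dual_var \<Rightarrow> ('n, 'm, 'h) dual_var \<Rightarrow> real \<Rightarrow> bool" where
  "step_bound U D \<nu> \<longleftrightarrow> (\<exists>L \<theta>. cholesky_factor (slack U) L \<and>
     \<theta> = min_eigenvalue (matrix_inv L ** opB P D ** matrix_inv (transpose L)) \<and>
     \<nu> = (if \<theta> \<ge> 0 then 1 else min 1 (- tau R / \<theta>)))"

lemma spg_step_iff:
  "spg_step P R U k a U' a' \<longleftrightarrow> (\<exists>\<nu> j. step_bound (U k) (proj_step P a (U k)) \<nu> \<and>
     line_search_ok P R U k (proj_step P a (U k)) \<nu> (beta R ^ j) \<and>
     (\<forall>i. line_search_ok P R U k (proj_step P a (U k)) \<nu> (beta R ^ i) \<longrightarrow> beta R ^ i \<le> beta R ^ j) \<and>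
     U' = U k + (beta R ^ j * \<nu>) *\<^sub>R proj_step P a (U k) \<and> a' = next_alpha P R (U k) U')"
  unfolding spg_step_def step_bound_def by blast

lemma step_bound_exists:
  assumes "U \<in> dual_feasible P"
  shows "\<exists>\<nu>. step_bound U D \<nu>"
  using cholesky_factor_exists[of "slack U"] assms
  unfolding step_bound_def dual_feasible_def by blast

lemma step_boundD:
  assumes "U \<in> dual_feasible P" "0 < a" and "step_bound U (proj_step P a U) \<nu>"
  shows "0 < \<nu>" and "\<nu> \<le> 1"
    and "0 \<le> t \<Longrightarrow> t \<le> \<nu> \<Longrightarrow> U + t *\<^sub>R proj_step P a U \<in> dual_feasible P"
    and "0 \<le> t \<Longrightarrow> t \<le> \<nu> \<Longrightarrow>
      (1 - tau R) * (v \<bullet> (slack U *v v)) \<le> v \<bullet> (slack (U + t *\<^sub>R proj_step P a U) *v v)"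
proof -
  have D: "U + proj_step P a U \<in> setM P"
    using assms(1,2) by (intro proj_step_props(1)) (auto simp: dual_feasible_def)
  obtain L \<theta> where *: "cholesky_factor (slack U) L"
    "\<theta> = min_eigenvalue (matrix_inv L ** opB P (proj_step P a U) ** matrix_inv (transpose L))"
    "\<nu> = (if \<theta> \<ge> 0 then 1 else min 1 (- tau R / \<theta>))"
    using assms(3) unfolding step_bound_def by blast
  note props = step_bound_feasible[OF assms(1) D *(1) tau *(2,3)]
  show "0 < \<nu>" "\<nu> \<le> 1" by (rule props)+
  show "U + t *\<^sub>R proj_step P a U \<in> dual_feasible P" if "0 \<le> t" "t \<le> \<nu>"
    using that by (rule props(3))
  show "(1 - tau R) * (v \<bullet> (slack U *v v)) \<le> v \<bullet> (slack (U + t *\<^sub>R proj_step P a U) *v v)"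
    if "0 \<le> t" "t \<le> \<nu>"
    using that by (rule props(4))
qed

text \<open>At a vector where the generalized eigenvalue is attained, \<open>- \<theta>\<close>
  times the form of the slack is at most a multiple of the norm of the step. Definiteness of the
  slack and the bound \<open>r\<close> on the step therefore cap \<open>- \<theta>\<close>.\<close>

lemma step_bound_lower:
  assumes "0 < \<eta>" "0 < r"
  obtains \<nu>\<^sub>0 where "0 < \<nu>\<^sub>0"
    and "\<And>U a \<nu>. U \<in> dual_feasible P \<Longrightarrow> 0 < a \<Longrightarrow> (\<And>v. \<eta> * (v \<bullet> v) \<le> v \<bullet> (slack U *v v)) \<Longrightarrow>
      norm (proj_step P a U) \<le> r \<Longrightarrow> step_bound U (proj_step P a U) \<nu> \<Longrightarrow> \<nu>\<^sub>0 \<le> \<nu>"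
proof -
  obtain K where K: "0 < K"
    "\<And>(A :: real^'n::{finite,linorder}^'n::{finite,linorder}) v. norm (A *v v) \<le> norm A * norm v * K"
    using bounded_bilinear.pos_bounded[OF bounded_bilinear_matrix_vector_mult] by blast
  obtain B where B: "0 < B" "\<And>U. norm (opB P U) \<le> B * norm U"
    using opB_bounded by blast
  have "min 1 (tau R * \<eta> / (B * r * K)) \<le> \<nu>"
    if U: "U \<in> dual_feasible P" and "0 < a" and bnd: "\<And>v. \<eta> * (v \<bullet> v) \<le> v \<bullet> (slack U *v v)"
      and r: "norm (proj_step P a U) \<le> r" and \<nu>: "step_bound U (proj_step P a U) \<nu>"
    for U a \<nu>
  proof -
    let ?D = "proj_step P a U"
    have D: "U + ?D \<in> setM P"
      using U \<open>0 < a\<close> by (intro proj_step_props(1)) (auto simp: dual_feasible_def)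
    obtain L \<theta> where *: "cholesky_factor (slack U) L"
      "\<theta> = min_eigenvalue (matrix_inv L ** opB P ?D ** matrix_inv (transpose L))"
      "\<nu> = (if \<theta> \<ge> 0 then 1 else min 1 (- tau R / \<theta>))"
      using \<nu> unfolding step_bound_def by blast
    show ?thesis
    proof (cases "0 \<le> \<theta>")
      case True
      then show ?thesis using *(3) by simp
    next
      case False
      obtain w where w: "w \<noteq> 0" "w \<bullet> (opB P ?D *v w) = \<theta> * (w \<bullet> (slack U *v w))"
        using step_bound_feasible(5)[OF U D *(1) tau *(2,3)] by blast
      have "(- \<theta>) * (\<eta> * (w \<bullet> w)) \<le> (- \<theta>) * (w \<bullet> (slack U *v w))"
        using False by (intro mult_left_mono bnd) auto
      also have "\<dots> = - w \<bullet> (opB P ?D *v w)"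
        by (simp add: w(2))
      also have "\<dots> \<le> norm w * norm (opB P ?D *v w)"
        using norm_cauchy_schwarz[of "- w"] by simp
      also have "\<dots> \<le> norm w * (norm (opB P ?D) * norm w * K)"
        by (intro mult_left_mono K(2)) auto
      also have "\<dots> \<le> norm w * ((B * r) * norm w * K)"
        using K(1) B(1) r
        by (intro mult_left_mono mult_right_mono order_trans[OF B(2)]) auto
      finally have "(- \<theta>) * \<eta> * (norm w * norm w) \<le> (B * r * K) * (norm w * norm w)"
        by (simp add: power2_norm_eq_inner[symmetric] power2_eq_square ac_simps)
      then have "(- \<theta>) * \<eta> \<le> B * r * K"
        using w(1) by (simp only: mult_le_cancel_right) (simp add: not_less mult_le_0_iff)
      then have "tau R * ((- \<theta>) * \<eta>) \<le> tau R * (B * r * K)"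
        using tau(1) by (intro mult_left_mono) auto
      then have "tau R * \<eta> / (B * r * K) \<le> - tau R / \<theta>"
        using False B(1) K(1) assms by (simp add: field_simps)
      then show ?thesis using *(3) False by auto
    qed
  qed
  moreover have "0 < min 1 (tau R * \<eta> / (B * r * K))"
    using tau(1) B(1) K(1) assms by simp
  ultimately show thesis using that by blast
qed

text \<open>The facts about the objective that the convergence argument uses, with constants that
  depend only on the level \<open>c\<close>: a lower bound for the step bound, a length
  \<open>t\<^sub>1\<close> up to which even the monotone line search test holds, a gap estimate and
  a one-sided Lipschitz bound.\<close>

lemma level_set_constants:
  obtains t\<^sub>1 \<nu>\<^sub>0 K G where "0 < t\<^sub>1" "0 < \<nu>\<^sub>0" "0 \<le> K" "0 \<le> G"
    and "\<And>U a \<nu>. U \<in> dual_feasible P \<Longrightarrow> c \<le> dual_obj P U \<Longrightarrow> alpha_min R \<le> a \<Longrightarrow> a \<le> alpha_max R \<Longrightarrow>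
      step_bound U (proj_step P a U) \<nu> \<Longrightarrow> \<nu>\<^sub>0 \<le> \<nu>"
    and "\<And>U a \<nu> t. U \<in> dual_feasible P \<Longrightarrow> c \<le> dual_obj P U \<Longrightarrow> alpha_min R \<le> a \<Longrightarrow> a \<le> alpha_max R \<Longrightarrow>
      step_bound U (proj_step P a U) \<nu> \<Longrightarrow> 0 \<le> t \<Longrightarrow> t \<le> \<nu> \<Longrightarrow> t \<le> t\<^sub>1 \<Longrightarrow>
      dual_obj P U + gamma R * t * (dual_grad P U \<bullet> proj_step P a U)
        \<le> dual_obj P (U + t *\<^sub>R proj_step P a U)"
    and "\<And>U V a. U \<in> dual_feasible P \<Longrightarrow> c \<le> dual_obj P U \<Longrightarrow> alpha_min R \<le> a \<Longrightarrow> V \<in> dual_feasible P \<Longrightarrow>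
      dual_obj P V - dual_obj P U \<le> K * norm (proj_step P a U)"
    and "\<And>U V. U \<in> dual_feasible P \<Longrightarrow> V \<in> dual_feasible P \<Longrightarrow> c \<le> dual_obj P V \<Longrightarrow>
      dual_obj P U - G * norm (V - U) \<le> dual_obj P V"
proof -
  let ?am = "alpha_min R" and ?aM = "alpha_max R"
  obtain \<eta> r where \<eta>: "0 < \<eta>"
    and r: "\<And>U. U \<in> dual_feasible P \<Longrightarrow> c \<le> dual_obj P U \<Longrightarrow> norm U \<le> r"
    and bnd: "\<And>U v. U \<in> dual_feasible P \<Longrightarrow> c \<le> dual_obj P U \<Longrightarrow> \<eta> * (v \<bullet> v) \<le> v \<bullet> (slack U *v v)"
    using dual_level_set[of c] by blast
  obtain G where G: "0 < G"
    and grad: "\<And>U. U \<in> dual_feasible P \<Longrightarrow> (\<And>v. \<eta> * (v \<bullet> v) \<le> v \<bullet> (slack U *v v)) \<Longrightarrow> norm (dual_grad P U) \<le> G"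
    using dual_grad_bounded[OF \<eta>] by blast
  \<comment> \<open>A damped step may shrink the definiteness bound by the factor
    \<open>1 - tau R\<close>. The quadratic lower bound is taken with the smaller constant, valid at
    both ends without knowing the level of the new point.\<close>
  define \<eta>' where "\<eta>' = (1 - tau R) * \<eta>"
  have \<eta>': "0 < \<eta>'" "\<eta>' \<le> \<eta>"
    using \<eta> tau mult_right_mono[of "1 - tau R" 1 \<eta>] by (auto simp: \<eta>'_def)
  obtain \<Lambda> where \<Lambda>: "0 < \<Lambda>"
    and quad: "\<And>U V. U \<in> dual_feasible P \<Longrightarrow> V \<in> dual_feasible P \<Longrightarrow>
          (\<And>v. \<eta>' * (v \<bullet> v) \<le> v \<bullet> (slack U *v v)) \<Longrightarrow> (\<And>v. \<eta>' * (v \<bullet> v) \<le> v \<bullet> (slack V *v v)) \<Longrightarrow>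
          dual_obj P U + dual_grad P U \<bullet> (V - U) - \<Lambda> * (norm (V - U))\<^sup>2 \<le> dual_obj P V"
    using dual_obj_quadratic_lower[OF \<eta>'(1)] by blast
  have am: "0 < ?am" "0 < ?aM" using alpha_bounds by auto
  obtain \<nu>\<^sub>0 where \<nu>\<^sub>0: "0 < \<nu>\<^sub>0"
    and \<nu>_ge: "\<And>U a \<nu>. U \<in> dual_feasible P \<Longrightarrow> 0 < a \<Longrightarrow> (\<And>v. \<eta> * (v \<bullet> v) \<le> v \<bullet> (slack U *v v)) \<Longrightarrow>
      norm (proj_step P a U) \<le> ?aM * G \<Longrightarrow> step_bound U (proj_step P a U) \<nu> \<Longrightarrow> \<nu>\<^sub>0 \<le> \<nu>"
    using step_bound_lower[OF \<eta>, of "?aM * G"] am(2) G mult_pos_pos by blast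
  \<comment> \<open>For \<open>t\<close> up to this value, the quadratic error
    \<open>\<Lambda> * t * (norm D)\<^sup>2\<close> is at most the share \<open>1 - gamma R\<close>
    of the gradient term, because \<open>(norm D)\<^sup>2\<close> is at most
    \<open>alpha_max R\<close> times that term.\<close>
  define t\<^sub>1 where "t\<^sub>1 = (1 - gamma R) / (\<Lambda> * ?aM)"
  have t\<^sub>1: "0 < t\<^sub>1" using gamma \<Lambda> am by (simp add: t\<^sub>1_def)
  have bound: "\<nu>\<^sub>0 \<le> \<nu>" if U: "U \<in> dual_feasible P" "c \<le> dual_obj P U" and a: "?am \<le> a" "a \<le> ?aM"
    and \<nu>: "step_bound U (proj_step P a U) \<nu>" for U a \<nu>
  proof -
    have "norm (proj_step P a U) \<le> a * norm (dual_grad P U)"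
      using U am a by (intro proj_step_props(3)) (auto simp: dual_feasible_def)
    also have "\<dots> \<le> ?aM * G"
      using a am by (intro mult_mono grad bnd U) auto
    finally show ?thesis
      using U am a bnd by (intro \<nu>_ge[OF _ _ _ _ \<nu>]) auto
  qed
  have armijo: "dual_obj P U + gamma R * t * (dual_grad P U \<bullet> proj_step P a U)
      \<le> dual_obj P (U + t *\<^sub>R proj_step P a U)"
    if U: "U \<in> dual_feasible P" "c \<le> dual_obj P U" and a: "?am \<le> a" "a \<le> ?aM"
      and \<nu>: "step_bound U (proj_step P a U) \<nu>" and t: "0 \<le> t" "t \<le> \<nu>" "t \<le> t\<^sub>1" for U a \<nu> t
  proof -
    let ?D = "proj_step P a U" and ?g = "dual_grad P U"
    have a0: "0 < a" using a am by linarith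
    have V: "U + t *\<^sub>R ?D \<in> dual_feasible P"
      by (rule step_boundD(3)[OF U(1) a0 \<nu> t(1,2)])
    have sq: "(norm ?D)\<^sup>2 \<le> a * (?g \<bullet> ?D)"
      using U a0 by (intro proj_step_props(2)) (auto simp: dual_feasible_def)
    then have gD: "0 \<le> ?g \<bullet> ?D"
      using a0 by (meson order_trans zero_le_mult_iff zero_le_power2 not_less)
    have "\<Lambda> * t * (norm ?D)\<^sup>2 \<le> \<Lambda> * t\<^sub>1 * (?aM * (?g \<bullet> ?D))"
      using \<Lambda> t t\<^sub>1 a gD sq
      by (intro mult_mono order_trans[OF sq] mult_right_mono) auto
    also have "\<dots> = (1 - gamma R) * (?g \<bullet> ?D)"
      using \<Lambda> am by (simp add: t\<^sub>1_def)
    finally have small: "t * (\<Lambda> * t * (norm ?D)\<^sup>2) \<le> t * ((1 - gamma R) * (?g \<bullet> ?D))"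
      using t(1) by (rule mult_left_mono)
    have "dual_obj P U + ?g \<bullet> (t *\<^sub>R ?D) - \<Lambda> * (norm (t *\<^sub>R ?D))\<^sup>2 \<le> dual_obj P (U + t *\<^sub>R ?D)"
    proof -
      have "\<eta>' * (v \<bullet> v) \<le> v \<bullet> (slack U *v v)" for v
        using mult_right_mono[OF \<eta>'(2), of "v \<bullet> v"] bnd[OF U, of v] by simp
      moreover have "\<eta>' * (v \<bullet> v) \<le> v \<bullet> (slack (U + t *\<^sub>R ?D) *v v)" for v
        unfolding \<eta>'_def mult.assoc using tau
        by (intro order_trans[OF mult_left_mono[OF bnd[OF U]] step_boundD(4)[OF U(1) a0 \<nu> t(1,2)]]) auto
      ultimately show ?thesis
        using quad[OF U(1) V] by simp
    qed
    with small show ?thesis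
      by (simp add: power_mult_distrib power2_eq_square algebra_simps)
  qed
  \<comment> \<open>If \<open>V\<close> lies in the level set, its distance from \<open>U\<close> is
    at most \<open>2 * \<bar>r\<bar>\<close>; otherwise its value is below that of \<open>U\<close>
    and the left side is negative.\<close>
  have gap: "dual_obj P V - dual_obj P U \<le> (G + 2 * \<bar>r\<bar> / ?am) * norm (proj_step P a U)"
    if U: "U \<in> dual_feasible P" "c \<le> dual_obj P U" and a: "?am \<le> a" and V: "V \<in> dual_feasible P" for U V a
  proof (cases "c \<le> dual_obj P V")
    case True
    have "dual_obj P V - dual_obj P U
        \<le> (norm (dual_grad P U) + norm (V - U) / a) * norm (proj_step P a U)"
      using a am by (intro dual_gap_le U V) auto
    also have "\<dots> \<le> (G + 2 * \<bar>r\<bar> / ?am) * norm (proj_step P a U)"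
    proof (intro mult_right_mono add_mono norm_ge_zero grad U bnd frac_le)
      show "norm (V - U) \<le> 2 * \<bar>r\<bar>"
        using norm_triangle_ineq4[of V U] r[OF U] r[OF V True] by linarith
    qed (use a am in auto)
    finally show ?thesis .
  next
    case False
    moreover have "0 \<le> (G + 2 * \<bar>r\<bar> / ?am) * norm (proj_step P a U)"
      using G am by auto
    ultimately show ?thesis using U(2) by linarith
  qed
  \<comment> \<open>With the tangent taken at \<open>V\<close>, only the gradient at
    \<open>V\<close> has to be bounded.\<close>
  have lip: "dual_obj P U - G * norm (V - U) \<le> dual_obj P V"
    if U: "U \<in> dual_feasible P" and V: "V \<in> dual_feasible P" "c \<le> dual_obj P V" for U V
  proof -
    have "dual_obj P U \<le> dual_obj P V + dual_grad P V \<bullet> (U - V)"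
      by (rule dual_obj_tangent[OF V(1) U])
    also have "dual_grad P V \<bullet> (U - V) \<le> norm (dual_grad P V) * norm (U - V)"
      by (rule norm_cauchy_schwarz)
    also have "\<dots> \<le> G * norm (V - U)"
      by (subst norm_minus_commute) (intro mult_right_mono grad bnd V norm_ge_zero)
    finally show ?thesis by simp
  qed
  have "0 \<le> G + 2 * \<bar>r\<bar> / ?am" using G am by simp
  then show thesis
    by (rule that[OF t\<^sub>1 \<nu>\<^sub>0 _ less_imp_le[OF G]]) (fact bound armijo gap lip)+
qed

section \<open>Runs of the algorithm\<close>

lemma next_alpha_bounds: "alpha_min R \<le> next_alpha P R U U'" "next_alpha P R U U' \<le> alpha_max R"
  using alpha_bounds by (auto simp: next_alpha_def Let_def)

lemma window_min_le: "Min ((\<lambda>l. dual_obj P (U l)) ` {k + 1 - memory R..k}) \<le> dual_obj P (U k)"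
  using memory_pos by (intro Min_le) auto

lemma window_min_ge:
  assumes "\<And>l. l \<le> k \<Longrightarrow> c \<le> dual_obj P (U l)"
  shows "c \<le> Min ((\<lambda>l. dual_obj P (U l)) ` {k + 1 - memory R..k})"
  using assms memory_pos by (intro Min.boundedI) auto

text \<open>Backtracking succeeds because the powers of \<open>beta R\<close> drop below
  \<open>t\<^sub>1\<close>, where the test holds relative to the current value and so relative to
  the window minimum. Hence a finite run can end only at the stopping test.\<close>

lemma spg_step_exists:
  assumes U: "U k \<in> dual_feasible P" and a: "alpha_min R \<le> a" "a \<le> alpha_max R"
  shows "\<exists>U' a'. spg_step P R U k a U' a'"
proof -
  let ?D = "proj_step P a (U k)"
  obtain \<nu> where \<nu>: "step_bound (U k) ?D \<nu>"
    using step_bound_exists[OF U] by blast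
  obtain t\<^sub>1 where t\<^sub>1: "0 < t\<^sub>1" and armijo: "\<And>t. 0 \<le> t \<Longrightarrow> t \<le> \<nu> \<Longrightarrow> t \<le> t\<^sub>1 \<Longrightarrow>
      dual_obj P (U k) + gamma R * t * (dual_grad P (U k) \<bullet> ?D) \<le> dual_obj P (U k + t *\<^sub>R ?D)"
    using level_set_constants[of "dual_obj P (U k)"] U a \<nu> order_refl by metis
  have "0 < a" using a alpha_bounds by linarith
  note \<nu>01 = step_boundD(1,2)[OF U \<open>0 < a\<close> \<nu>]
  obtain j where j: "beta R ^ j < t\<^sub>1"
    using real_arch_pow_inv[OF t\<^sub>1 beta(2)] by blast
  have "line_search_ok P R U k ?D \<nu> (beta R ^ j)"
  proof -
    have "beta R ^ j \<le> 1" using beta by (simp add: power_le_one)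
    then have "beta R ^ j * \<nu> \<le> \<nu>"
      using \<nu>01 beta by (auto simp: mult_left_le_one_le)
    moreover have "beta R ^ j * \<nu> \<le> beta R ^ j"
      using \<nu>01 beta by (auto simp: mult_left_le)
    then have "beta R ^ j * \<nu> \<le> t\<^sub>1"
      using j by linarith
    ultimately have "dual_obj P (U k) + gamma R * (beta R ^ j * \<nu>) * (dual_grad P (U k) \<bullet> ?D)
        \<le> dual_obj P (U k + (beta R ^ j * \<nu>) *\<^sub>R ?D)"
      using j \<nu>01 beta by (intro armijo) auto
    then show ?thesis
      using window_min_le[of U k] by (simp add: line_search_ok_def mult.assoc)
  qed
  \<comment> \<open>The least admissible exponent gives the largest admissible power, since
    \<open>beta R\<close> lies between 0 and 1.\<close>
  define j' where "j' = (LEAST j. line_search_ok P R U k ?D \<nu> (beta R ^ j))"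
  have "line_search_ok P R U k ?D \<nu> (beta R ^ j')"
    unfolding j'_def by (rule LeastI) fact
  moreover have "beta R ^ i \<le> beta R ^ j'" if "line_search_ok P R U k ?D \<nu> (beta R ^ i)" for i
    using Least_le[of "\<lambda>j. line_search_ok P R U k ?D \<nu> (beta R ^ j)", OF that] beta
    unfolding j'_def by (intro power_decreasing) auto
  ultimately show ?thesis
    unfolding spg_step_iff using \<nu> by blast
qed

lemma spg_step_feasible:
  assumes U: "U k \<in> dual_feasible P" and a: "alpha_min R \<le> a" "a \<le> alpha_max R"
    and c: "\<And>l. l \<le> k \<Longrightarrow> c \<le> dual_obj P (U l)"
    and step: "spg_step P R U k a U' a'"
  shows "U' \<in> dual_feasible P" and "c \<le> dual_obj P U'" and "alpha_min R \<le> a'" "a' \<le> alpha_max R"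
proof -
  let ?D = "proj_step P a (U k)"
  obtain \<nu> j where \<nu>: "step_bound (U k) ?D \<nu>" and ok: "line_search_ok P R U k ?D \<nu> (beta R ^ j)"
    and U': "U' = U k + (beta R ^ j * \<nu>) *\<^sub>R ?D" and a': "a' = next_alpha P R (U k) U'"
    using step unfolding spg_step_iff by blast
  have "0 < a" using a alpha_bounds by linarith
  note \<nu>01 = step_boundD(1,2)[OF U \<open>0 < a\<close> \<nu>]
  have "beta R ^ j \<le> 1" using beta by (simp add: power_le_one)
  then have "beta R ^ j * \<nu> \<le> \<nu>"
    using \<nu>01 beta by (auto simp: mult_left_le_one_le)
  then show "U' \<in> dual_feasible P"
    unfolding U' using \<nu>01 beta by (intro step_boundD(3)[OF U \<open>0 < a\<close> \<nu>]) auto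
  have "(norm ?D)\<^sup>2 \<le> a * (dual_grad P (U k) \<bullet> ?D)"
    using U \<open>0 < a\<close> by (intro proj_step_props(2)) (auto simp: dual_feasible_def)
  then have "0 \<le> dual_grad P (U k) \<bullet> ?D"
    using \<open>0 < a\<close> by (meson order_trans zero_le_mult_iff zero_le_power2 not_less)
  then have "0 \<le> gamma R * beta R ^ j * \<nu> * (dual_grad P (U k) \<bullet> ?D)"
    using gamma beta \<nu>01 by (intro mult_nonneg_nonneg) auto
  then show "c \<le> dual_obj P U'"
    using ok window_min_ge[of k c U, OF c] by (simp add: line_search_ok_def U')
  show "alpha_min R \<le> a'" "a' \<le> alpha_max R"
    unfolding a' by (rule next_alpha_bounds)+
qed

text \<open>Values may decrease from one iterate to the next, but not below the window minimum, so
  the level of \<open>U 0\<close> is never left. The next step needs this for the whole window,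
  hence the quantifier over all earlier indices.\<close>

lemma spg_run_invariant:
  assumes run: "spg_run P R U \<alpha> N" and "enat k \<le> N"
  shows "(\<forall>l\<le>k. dual_obj P (U 0) \<le> dual_obj P (U l)) \<and> U k \<in> dual_feasible P \<and>
    alpha_min R \<le> \<alpha> k \<and> \<alpha> k \<le> alpha_max R"
  using \<open>enat k \<le> N\<close>
proof (induction k)
  case 0
  then show ?case using run by (simp add: spg_run_def)
next
  case (Suc k)
  then have "enat k < N" by (simp add: Suc_ile_eq)
  then have IH: "\<And>l. l \<le> k \<Longrightarrow> dual_obj P (U 0) \<le> dual_obj P (U l)" "U k \<in> dual_feasible P"
    "alpha_min R \<le> \<alpha> k" "\<alpha> k \<le> alpha_max R"
    and step: "spg_step P R U k (\<alpha> k) (U (Suc k)) (\<alpha> (Suc k))"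
    using Suc.IH run by (auto simp: spg_run_def)
  note spg_step_feasible[OF IH(2,3,4,1) step]
  then show ?case using IH(1) by (auto simp: le_Suc_eq)
qed

lemma spg_run_finite:
  assumes run: "spg_run P R U \<alpha> (enat k)"
  shows "spg_stop P R (U k)" and "dual_obj P (U k) = dual_opt P"
proof -
  note inv = spg_run_invariant[OF run order_refl]
  then have "\<exists>U' a'. spg_step P R U k (\<alpha> k) U' a'"
    by (intro spg_step_exists) auto
  then show stop: "spg_stop P R (U k)"
    using run by (auto simp: spg_run_def)
  then show "dual_obj P (U k) = dual_opt P"
    using inv by (intro dual_opt_if_stationary) (auto simp: spg_stop_def eps_zero)
qed

lemma spg_run_infinite:
  assumes run: "spg_run P R U \<alpha> \<infinity>"
  shows "(\<lambda>k. dual_obj P (U k)) \<longlonglongrightarrow> dual_opt P"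
proof -
  define c where "c = dual_obj P (U 0)"
  have feas: "U k \<in> dual_feasible P" and level: "c \<le> dual_obj P (U k)"
    and \<alpha>: "alpha_min R \<le> \<alpha> k" "\<alpha> k \<le> alpha_max R" for k
    using spg_run_invariant[OF run, of k] by (auto simp: c_def)
  have \<alpha>0: "0 < \<alpha> k" for k using \<alpha>(1)[of k] alpha_bounds by linarith
  have step: "spg_step P R U k (\<alpha> k) (U (Suc k)) (\<alpha> (Suc k))" for k
    using run by (simp add: spg_run_def)
  define D where "D k = proj_step P (\<alpha> k) (U k)" for k
  obtain t\<^sub>1 \<nu>\<^sub>0 K G where pos: "0 < t\<^sub>1" "0 < \<nu>\<^sub>0" "0 \<le> K" "0 \<le> G"
    and \<nu>\<^sub>0: "\<And>k \<nu>. step_bound (U k) (D k) \<nu> \<Longrightarrow> \<nu>\<^sub>0 \<le> \<nu>"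
    and armijo: "\<And>k \<nu> t. step_bound (U k) (D k) \<nu> \<Longrightarrow> 0 \<le> t \<Longrightarrow> t \<le> \<nu> \<Longrightarrow> t \<le> t\<^sub>1 \<Longrightarrow>
      dual_obj P (U k) + gamma R * t * (dual_grad P (U k) \<bullet> D k) \<le> dual_obj P (U k + t *\<^sub>R D k)"
    and gap: "\<And>k V. V \<in> dual_feasible P \<Longrightarrow> dual_obj P V - dual_obj P (U k) \<le> K * norm (D k)"
    and lip: "\<And>k l. dual_obj P (U k) - G * norm (U l - U k) \<le> dual_obj P (U l)"
    unfolding D_def using level_set_constants[of c] feas level \<alpha> by metis
  \<comment> \<open>A lower bound for all accepted step lengths: either the first trial
    \<open>\<nu>\<close> is accepted, or the last rejected trial exceeded \<open>t\<^sub>1\<close>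
    and the accepted one is \<open>beta R\<close> times as long.\<close>
  define t\<^sub>0 where "t\<^sub>0 = min \<nu>\<^sub>0 (beta R * t\<^sub>1)"
  have t\<^sub>0: "0 < t\<^sub>0" using pos beta by (simp add: t\<^sub>0_def)
  have sq: "(norm (D k))\<^sup>2 \<le> \<alpha> k * (dual_grad P (U k) \<bullet> D k)" for k
    unfolding D_def using feas[of k] \<alpha>0 by (intro proj_step_props(2)) (auto simp: dual_feasible_def)
  have gD: "0 \<le> dual_grad P (U k) \<bullet> D k" for k
    using sq[of k] \<alpha>0[of k] by (meson order_trans zero_le_mult_iff zero_le_power2 not_less)
  have progress: "Min ((\<lambda>l. dual_obj P (U l)) ` {k + 1 - memory R..k})
        + gamma R * t\<^sub>0 / alpha_max R * (norm (D k))\<^sup>2 \<le> dual_obj P (U (Suc k))"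
    and short: "norm (U (Suc k) - U k) \<le> norm (D k)" for k
  proof -
    obtain \<nu> j where \<nu>: "step_bound (U k) (D k) \<nu>" and ok: "line_search_ok P R U k (D k) \<nu> (beta R ^ j)"
      and largest: "\<And>i. line_search_ok P R U k (D k) \<nu> (beta R ^ i) \<Longrightarrow> beta R ^ i \<le> beta R ^ j"
      and U': "U (Suc k) = U k + (beta R ^ j * \<nu>) *\<^sub>R D k"
      using step[of k] unfolding spg_step_iff D_def by blast
    have \<nu>01: "0 < \<nu>" "\<nu> \<le> 1"
      using step_boundD(1,2)[OF feas \<alpha>0] \<nu> unfolding D_def by blast+
    have pow: "0 < beta R ^ i" "beta R ^ i \<le> 1" for i
      using beta by (auto simp: power_le_one)
    have t\<^sub>0_le: "t\<^sub>0 \<le> beta R ^ j * \<nu>"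
    proof (cases j)
      case 0
      then show ?thesis using \<nu>\<^sub>0[OF \<nu>] by (simp add: t\<^sub>0_def)
    next
      case (Suc i)
      have "t\<^sub>1 < beta R ^ i * \<nu>"
      proof (rule ccontr)
        assume "\<not> t\<^sub>1 < beta R ^ i * \<nu>"
        moreover have "beta R ^ i * \<nu> \<le> \<nu>"
          using \<nu>01 pow[of i] by (auto simp: mult_left_le_one_le)
        ultimately have "dual_obj P (U k) + gamma R * (beta R ^ i * \<nu>) * (dual_grad P (U k) \<bullet> D k)
            \<le> dual_obj P (U k + (beta R ^ i * \<nu>) *\<^sub>R D k)"
          using \<nu>01 pow[of i] by (intro armijo[OF \<nu>]) auto
        then have "line_search_ok P R U k (D k) \<nu> (beta R ^ i)"
          using window_min_le[of U k] by (simp add: line_search_ok_def mult.assoc)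
        then have "beta R ^ i \<le> beta R * beta R ^ i"
          using largest Suc by simp
        then show False using pow(1)[of i] beta by simp
      qed
      then have "beta R * t\<^sub>1 \<le> beta R ^ j * \<nu>"
        using beta Suc by (simp add: mult.assoc)
      then show ?thesis by (simp add: t\<^sub>0_def)
    qed
    have "t\<^sub>0 / alpha_max R * (norm (D k))\<^sup>2 \<le> t\<^sub>0 / alpha_max R * (alpha_max R * (dual_grad P (U k) \<bullet> D k))"
      using t\<^sub>0 alpha_bounds \<alpha>[of k] gD[of k]
      by (intro mult_left_mono order_trans[OF sq] mult_right_mono) auto
    also have "\<dots> = t\<^sub>0 * (dual_grad P (U k) \<bullet> D k)"
      using alpha_bounds by simp
    also have "\<dots> \<le> beta R ^ j * \<nu> * (dual_grad P (U k) \<bullet> D k)"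
      by (intro mult_right_mono t\<^sub>0_le gD)
    finally have "gamma R * (t\<^sub>0 / alpha_max R * (norm (D k))\<^sup>2)
        \<le> gamma R * (beta R ^ j * \<nu> * (dual_grad P (U k) \<bullet> D k))"
      using gamma by (intro mult_left_mono) auto
    then show "Min ((\<lambda>l. dual_obj P (U l)) ` {k + 1 - memory R..k})
        + gamma R * t\<^sub>0 / alpha_max R * (norm (D k))\<^sup>2 \<le> dual_obj P (U (Suc k))"
      using ok by (simp add: line_search_ok_def U' mult.assoc)
    have "beta R ^ j * \<nu> \<le> 1"
      using pow[of j] \<nu>01 by (intro mult_le_one) auto
    then show "norm (U (Suc k) - U k) \<le> norm (D k)"
      using pow[of j] \<nu>01 by (simp add: U' mult_left_le_one_le abs_mult)
  qed
  \<comment> \<open>The gap estimate at the first iterate bounds the objective from above, which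
    makes \<open>dual_opt P\<close> a genuine supremum.\<close>
  have bdd: "bdd_above (dual_obj P ` dual_feasible P)"
    using gap[of _ 0] by (intro bdd_aboveI[of _ "K * norm (D 0) + dual_obj P (U 0)"]) (auto simp: diff_le_eq)
  show ?thesis
  proof (rule nonmonotone_line_search_limit[OF memory_pos _ pos(3) _ progress _ _ _ pos(4)])
    show "0 < gamma R * t\<^sub>0 / alpha_max R"
      using gamma t\<^sub>0 alpha_bounds by simp
    show "0 \<le> norm (D k)" for k by simp
    show "dual_obj P (U k) \<le> dual_opt P" for k
      unfolding dual_opt_def by (intro cSUP_upper feas bdd)
    show "dual_opt P - dual_obj P (U k) \<le> K * norm (D k)" for k
    proof -
      have "dual_opt P \<le> dual_obj P (U k) + K * norm (D k)"
        unfolding dual_opt_def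
      proof (rule cSUP_least)
        show "dual_feasible P \<noteq> {}" using feas by blast
        show "dual_obj P V \<le> dual_obj P (U k) + K * norm (D k)" if "V \<in> dual_feasible P" for V
          using gap[OF that, of k] by simp
      qed
      then show ?thesis by simp
    qed
    show "dual_obj P (U k) - G * norm (D k) \<le> dual_obj P (U (Suc k))" for k
      using lip[of k "Suc k"] mult_left_mono[OF short pos(4), of k] by linarith
  qed
qed

end

theorem theorem11:
  fixes P :: "('n::{finite,linorder}, 'm::finite, 'h::finite) logdet_problem"
    and R :: spg_params
    and U :: "nat \<Rightarrow> ('n, 'm, 'h) dual_var"
    and \<alpha> :: "nat \<Rightarrow> real"
    and N :: enat
  assumes C_sym: "costC P \<in> sym_mats"
    and mu_pos: "0 < barrier P"
    and lambda_nonneg: "\<And>h. 0 \<le> weight P h"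
    and p_ge_1: "\<And>h. 1 \<le> expo P h"
    and Q_linear: "\<And>h i. i < dimQ P h \<Longrightarrow> linear_on_sym (\<lambda>X. opQ P h X i)"
    and A_sym: "\<And>i. matA P i \<in> sym_mats"
    and A_indep: "inj (matA P)" "independent (range (matA P))"
    and primal_interior: "\<exists>X. pos_definite X \<and> opA P X = rhs P"
    and dual_nonempty: "dual_feasible P \<noteq> {}"
    and eps_zero: "eps R = 0"
    and tau: "0 < tau R" "tau R < 1"
    and gamma: "0 < gamma R" "gamma R < 1"
    and beta: "0 < beta R" "beta R < 1"
    and alpha_bounds: "0 < alpha_min R" "alpha_min R < alpha_max R"
    and memory_pos: "0 < memory R"
    and run: "spg_run P R U \<alpha> N"
  shows "(\<exists>k. N = enat k \<and> spg_stop P R (U k) \<and> dual_obj P (U k) = dual_opt P) \<or>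
         (N = \<infinity> \<and> (\<lambda>k. \<bar>dual_obj P (U k) - dual_opt P\<bar>) \<longlonglongrightarrow> 0)"
proof -
  interpret dual_spg P R
    by unfold_locales (fact assms)+
  show ?thesis
  proof (cases N)
    case (enat k)
    then show ?thesis
      using spg_run_finite[of U \<alpha> k] run by simp
  next
    case infinity
    then have "(\<lambda>k. dual_obj P (U k)) \<longlonglongrightarrow> dual_opt P"
      using run by (intro spg_run_infinite) simp
    then have "(\<lambda>k. \<bar>dual_obj P (U k) - dual_opt P\<bar>) \<longlonglongrightarrow> 0"
      using LIM_zero tendsto_rabs_zero by blast
    with infinity show ?thesis by blast
  qed
qed

end
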